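(* Let $B(t),t\in\mathbb{R}$, be a centered Gaussian process with stationary increments, continuous sample paths, $B(0)=0$ almost surely, and variance function $\sigma^2(t)=\mathrm{Var}(B(t))$, and let $W(t)=B(t)-\sigma^2(t)/2$, $t\in\mathbb{R}$. If $$\liminf_{t\to\infty}\frac{\sigma^2(t)}{\ln t}>8,$$ then $\mathcal{H}_W^0>0$.
   Context: The Pickands-type constant $\mathcal{H}_W^0$ is defined by $$\mathcal{H}_W^0=\lim_{T\to\infty}\frac1T\,\mathbb{E}\Bigl\{\sup_{t\in[0,T]}e^{W(t)}\Bigr\}.$$ It is a standing assumption that $\mathbb{E}\{\sup_{t\in K}e^{W(t)}\}<\infty$ for every compact $K\subset\mathbb{R}$. For $W$ as in the statement, the associated max-stable process $\xi_W(t)=\max_{i\ge1}P_ie^{W_i(t)}$ (with $(P_i)$ the points of a Poisson point process on $(0,\infty)$ with intensity $x^{-2}dx$ and $W_i$ independent copies of $W$, independent of $(P_i)$) is stationary, and consequently the limit defining $\mathcal{H}_W^0$ exists and is finite. *)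

theory Defs
  imports "HOL-Probability.Probability"
begin

(* Constants count as (degenerate) Gaussian variables: B 0 = 0, and increments may vanish. *)
definition gaussian_rv :: "'a measure \<Rightarrow> ('a \<Rightarrow> real) \<Rightarrow> bool" where
  "gaussian_rv M X \<longleftrightarrow> X \<in> borel_measurable M \<and>
     ((\<exists>\<mu>. AE \<omega> in M. X \<omega> = \<mu>) \<or>
      (\<exists>\<mu> \<sigma>. \<sigma> > 0 \<and> distributed M lborel X (\<lambda>x. ennreal (normal_density \<mu> \<sigma> x))))"

(* Finite-dimensional distributions are (possibly degenerate) multivariate normal, i.e. every
   finite linear combination is univariate normal. *)
definition gaussian_process :: "'a measure \<Rightarrow> (real \<Rightarrow> 'a \<Rightarrow> real) \<Rightarrow> bool" where
  "gaussian_process M B \<longleftrightarrow>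
     (\<forall>I a. finite I \<longrightarrow> gaussian_rv M (\<lambda>\<omega>. \<Sum>t\<in>I. a t * B t \<omega>))"

definition centered_process :: "'a measure \<Rightarrow> (real \<Rightarrow> 'a \<Rightarrow> real) \<Rightarrow> bool" where
  "centered_process M B \<longleftrightarrow> (\<forall>t. prob_space.expectation M (B t) = 0)"

(* Equality of laws on the product sigma-algebra, i.e. of all finite-dimensional distributions. *)
definition stationary_increments :: "'a measure \<Rightarrow> (real \<Rightarrow> 'a \<Rightarrow> real) \<Rightarrow> bool" where
  "stationary_increments M B \<longleftrightarrow>
     (\<forall>h. distr M (PiM UNIV (\<lambda>_. borel)) (\<lambda>\<omega> t. B (t + h) \<omega> - B h \<omega>) =
          distr M (PiM UNIV (\<lambda>_. borel)) (\<lambda>\<omega> t. B t \<omega> - B 0 \<omega>))"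

definition continuous_paths :: "'a measure \<Rightarrow> (real \<Rightarrow> 'a \<Rightarrow> real) \<Rightarrow> bool" where
  "continuous_paths M B \<longleftrightarrow> (\<forall>\<omega>\<in>space M. continuous_on UNIV (\<lambda>t. B t \<omega>))"

definition variance_function :: "'a measure \<Rightarrow> (real \<Rightarrow> 'a \<Rightarrow> real) \<Rightarrow> real \<Rightarrow> real" where
  "variance_function M B t = prob_space.variance M (B t)"

definition drifted_process ::
    "'a measure \<Rightarrow> (real \<Rightarrow> 'a \<Rightarrow> real) \<Rightarrow> real \<Rightarrow> 'a \<Rightarrow> real" where
  "drifted_process M B t \<omega> = B t \<omega> - variance_function M B t / 2"

definition sup_exp :: "(real \<Rightarrow> 'a \<Rightarrow> real) \<Rightarrow> real set \<Rightarrow> 'a \<Rightarrow> real" where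
  "sup_exp W K \<omega> = (SUP t\<in>K. exp (W t \<omega>))"

(* The supremum over the empty set is unspecified in type real, hence K is nonempty. *)
definition compact_sup_integrable :: "'a measure \<Rightarrow> (real \<Rightarrow> 'a \<Rightarrow> real) \<Rightarrow> bool" where
  "compact_sup_integrable M W \<longleftrightarrow>
     (\<forall>K. compact K \<longrightarrow> K \<noteq> {} \<longrightarrow> integrable M (sup_exp W K))"

definition pickands_mean :: "'a measure \<Rightarrow> (real \<Rightarrow> 'a \<Rightarrow> real) \<Rightarrow> real \<Rightarrow> real" where
  "pickands_mean M W T = 1 / T * prob_space.expectation M (sup_exp W {0..T})"

(* Meaningful only if the limit exists; Lim is unspecified otherwise. *)
definition pickands_constant :: "'a measure \<Rightarrow> (real \<Rightarrow> 'a \<Rightarrow> real) \<Rightarrow> real" where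
  "pickands_constant M W = Lim at_top (pickands_mean M W)"

end

(* Write f(T) for the expectation of the supremum of exp(W) over [0,T].

   Tilting the law of the process by the density exp(W(h)) turns the increments W(. + h) - W(h) into
   a copy of W: by the Cameron-Martin shift, the covariance of B(t + h) - B(h) with B(h) exactly
   replaces the drift of the increments by that of W. Hence the expected supremum over [h, h + T]
   equals f(T), so f is subadditive and f(T)/T converges by Fekete's argument.

   For positivity, the maximum of nonnegative numbers x_k is at least the sum of the x_k minus the sum
   of sqrt(x_j x_k) over j < k. Apply this to x_k = exp(W(ka)): each x_k has mean 1, and
   sqrt(x_j x_k) has mean exp(-sigma^2((k - j)a)/8), at most ((k - j)a)^(-p) with p > 1 by the growth
   hypothesis. For a large lattice spacing a these terms cost at most 1/2 per point, so f(na) >= n/2. *)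
theory Submission
  imports Defs
begin

section \<open>Uniqueness of finite-dimensional laws\<close>

text \<open>An expected supremum depends on the joint law of the values, so the effect of the tilt
  must be identified on all finite sets of times at once. Gaussian vectors may be degenerate and
  then have no joint density; joint laws are therefore compared through characteristic functions of
  linear combinations, and only one-dimensional Levy uniqueness is used, one coordinate at a time.
  The passage from finite sets to intervals uses path continuity and monotone convergence in
  \<open>ennreal\<close>; integrability of the suprema brings the identity back to the reals.

  Fekete's limit is an infimum of quotients and could be 0, so positivity needs its own lower bound,
  linear in T. There the threshold 8 appears: a pair of points at distance t costs
  exp(-sigma^2(t)/8), so growth c ln t turns the cost into t^(-c/8), which is summable over a
  lattice exactly when c > 8.\<close>

text \<open>The value of \<open>char\<close> at 0 is the total mass, so both measures have the same
  mass \<open>c\<close>. If \<open>c\<close> is positive, dividing by it reduces the claim to Levy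
  uniqueness for probability measures. Finite measures are needed because the proofs below restrict
  and reweight measures without renormalising.\<close>

lemma finite_measure_eqI_char:
  fixes \<mu> \<nu> :: "real measure"
  assumes fin: "finite_measure \<mu>" "finite_measure \<nu>"
    and sets[simp, measurable_cong]: "sets \<mu> = sets borel" "sets \<nu> = sets borel"
    and char: "\<And>t. char \<mu> t = char \<nu> t"
  shows "\<mu> = \<nu>"
proof -
  interpret m: finite_measure \<mu> by fact
  interpret n: finite_measure \<nu> by fact
  have sp[simp]: "space \<mu> = UNIV" "space \<nu> = UNIV"
    using sets_eq_imp_space_eq[OF sets(1)] sets_eq_imp_space_eq[OF sets(2)] by auto
  define c where "c = measure \<mu> UNIV"
  have c2: "measure \<nu> UNIV = c"
    using char[of 0] by (simp add: char_def c_def)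
  show ?thesis
  proof (cases "c = 0")
    case True
    have "emeasure \<mu> UNIV = 0" "emeasure \<nu> UNIV = 0"
      using True c2 by (simp_all add: c_def m.emeasure_eq_measure n.emeasure_eq_measure)
    then have "emeasure \<mu> A = 0" "emeasure \<nu> A = 0" for A
      using emeasure_mono[of A UNIV \<mu>] emeasure_mono[of A UNIV \<nu>] by auto
    then show ?thesis by (intro measure_eqI) auto
  next
    case False
    then have c: "c > 0" by (simp add: c_def zero_less_measure_iff)
    let ?m = "density \<mu> (\<lambda>_. ennreal (1/c))" and ?n = "density \<nu> (\<lambda>_. ennreal (1/c))"
    have "real_distribution ?m" "real_distribution ?n"
      using c c2
      by (auto simp: real_distribution_def real_distribution_axioms_def emeasure_density_const
          m.emeasure_eq_measure n.emeasure_eq_measure c_def[symmetric] ennreal_mult[symmetric]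
          intro!: prob_spaceI)
    moreover have "char ?m = char ?n"
    proof
      fix t
      have "char ?m t = (1/c) *\<^sub>R char \<mu> t" "char ?n t = (1/c) *\<^sub>R char \<nu> t"
        using c unfolding char_def by (subst integral_density; simp)+
      then show "char ?m t = char ?n t" using char by simp
    qed
    ultimately have eq: "?m = ?n" by (rule Levy_uniqueness)
    show ?thesis
    proof (intro measure_eqI)
      fix A assume A: "A \<in> sets \<mu>"
      have "emeasure ?m A = emeasure ?n A" by (simp add: eq)
      then have "ennreal (1/c) * ennreal (measure \<mu> A) = ennreal (1/c) * ennreal (measure \<nu> A)"
        using A by (simp add: emeasure_density_const m.emeasure_eq_measure n.emeasure_eq_measure)
      then have "measure \<mu> A = measure \<nu> A"
        using c by (simp add: ennreal_mult[symmetric])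
      then show "emeasure \<mu> A = emeasure \<nu> A"
        by (simp add: m.emeasure_eq_measure n.emeasure_eq_measure)
    qed simp
  qed
qed

lemma (in finite_measure) integrable_iexp_bounded:
  assumes "f \<in> borel_measurable M" "X \<in> borel_measurable M" "\<And>\<omega>. \<bar>f \<omega>\<bar> \<le> C"
  shows "integrable M (\<lambda>\<omega>. complex_of_real (f \<omega>) * iexp (X \<omega>))"
  using assms by (intro integrable_const_bound[of _ C]) (auto simp: norm_mult)

text \<open>A weight \<open>f\<close> of changing sign defines no measure, but \<open>1 + f\<close>
  is nonnegative. The images of the measure with weight 1 and with weight \<open>1 + f\<close> are
  both determined by their characteristic functions, and the claim is the difference of the two
  identities.\<close>

lemma weighted_integral_indicator_eqI_char:
  fixes f1 X1 :: "'a \<Rightarrow> real" and f2 X2 :: "'b \<Rightarrow> real"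
  assumes "finite_measure M1" "finite_measure M2"
    and [measurable]: "X1 \<in> borel_measurable M1" "X2 \<in> borel_measurable M2"
      "f1 \<in> borel_measurable M1" "f2 \<in> borel_measurable M2"
    and f: "\<And>\<omega>. \<bar>f1 \<omega>\<bar> \<le> 1" "\<And>\<omega>. \<bar>f2 \<omega>\<bar> \<le> 1"
    and eq: "\<And>t. (CLINT \<omega>|M1. iexp (t * X1 \<omega>)) = (CLINT \<omega>|M2. iexp (t * X2 \<omega>))"
    and eqf: "\<And>t. (CLINT \<omega>|M1. f1 \<omega> * iexp (t * X1 \<omega>)) = (CLINT \<omega>|M2. f2 \<omega> * iexp (t * X2 \<omega>))"
    and A[measurable]: "A \<in> sets borel"
  shows "(LINT \<omega>|M1. f1 \<omega> * indicator A (X1 \<omega>)) = (LINT \<omega>|M2. f2 \<omega> * indicator A (X2 \<omega>))"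
proof -
  interpret M1: finite_measure M1 by fact
  interpret M2: finite_measure M2 by fact
  have pos: "0 \<le> 1 + f1 \<omega>" "0 \<le> 1 + f2 \<omega>'" for \<omega> \<omega>'
    using f(1)[of \<omega>] f(2)[of \<omega>'] by auto
  have le2: "\<bar>1 + f1 \<omega>\<bar> \<le> 2" "\<bar>1 + f2 \<omega>'\<bar> \<le> 2" for \<omega> \<omega>'
    using f(1)[of \<omega>] f(2)[of \<omega>'] by auto
  let ?D1 = "distr M1 borel X1" and ?D2 = "distr M2 borel X2"
  let ?N1 = "distr (density M1 (\<lambda>\<omega>. ennreal (1 + f1 \<omega>))) borel X1"
  let ?N2 = "distr (density M2 (\<lambda>\<omega>. ennreal (1 + f2 \<omega>))) borel X2"
  have D: "?D1 = ?D2"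
  proof (rule finite_measure_eqI_char)
    show "char ?D1 t = char ?D2 t" for t
      using eq[of t] by (simp add: char_def integral_distr)
  qed (auto intro!: M1.finite_measure_distr M2.finite_measure_distr)
  have int: "integrable M1 (\<lambda>\<omega>. 1 + f1 \<omega>)" "integrable M2 (\<lambda>\<omega>. 1 + f2 \<omega>)"
    using le2 by (auto intro!: M1.integrable_const_bound[of _ 2] M2.integrable_const_bound[of _ 2])
  have N: "?N1 = ?N2"
  proof (rule finite_measure_eqI_char)
    show "finite_measure ?N1" "finite_measure ?N2"
      using int pos
      by (intro finite_measure.finite_measure_distr finite_measureI;
        simp add: emeasure_density nn_integral_eq_integral)+
    fix t
    have "char ?N1 t = (CLINT \<omega>|M1. iexp (t * X1 \<omega>) + f1 \<omega> * iexp (t * X1 \<omega>))"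
      using pos unfolding char_def
      by (simp add: integral_distr integral_density scaleR_conv_of_real algebra_simps)
    also have "\<dots> = (CLINT \<omega>|M1. iexp (t * X1 \<omega>)) + (CLINT \<omega>|M1. f1 \<omega> * iexp (t * X1 \<omega>))"
      using f M1.integrable_iexp_bounded[of "\<lambda>_. 1" "\<lambda>\<omega>. t * X1 \<omega>" 1]
      by (intro Bochner_Integration.integral_add M1.integrable_iexp_bounded[where C=1]) auto
    also have "\<dots> = (CLINT \<omega>|M2. iexp (t * X2 \<omega>)) + (CLINT \<omega>|M2. f2 \<omega> * iexp (t * X2 \<omega>))"
      by (simp only: eq eqf)
    also have "\<dots> = (CLINT \<omega>|M2. iexp (t * X2 \<omega>) + f2 \<omega> * iexp (t * X2 \<omega>))"
      using f M2.integrable_iexp_bounded[of "\<lambda>_. 1" "\<lambda>\<omega>. t * X2 \<omega>" 1]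
      by (intro Bochner_Integration.integral_add[symmetric] M2.integrable_iexp_bounded[where C=1]) auto
    also have "\<dots> = char ?N2 t"
      using pos unfolding char_def
      by (simp add: integral_distr integral_density scaleR_conv_of_real algebra_simps)
    finally show "char ?N1 t = char ?N2 t" .
  qed auto
  let ?i = "indicator A :: real \<Rightarrow> real"
  have i: "integrable M1 (\<lambda>\<omega>. ?i (X1 \<omega>))" "integrable M2 (\<lambda>\<omega>. ?i (X2 \<omega>))"
    "integrable M1 (\<lambda>\<omega>. f1 \<omega> * ?i (X1 \<omega>))" "integrable M2 (\<lambda>\<omega>. f2 \<omega> * ?i (X2 \<omega>))"
    using f by (auto intro!: M1.integrable_const_bound[of _ 1] M2.integrable_const_bound[of _ 1]
        split: split_indicator)
  have 1: "(LINT x|?D1. ?i x) = (LINT \<omega>|M1. ?i (X1 \<omega>))" "(LINT x|?D2. ?i x) = (LINT \<omega>|M2. ?i (X2 \<omega>))"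
    by (subst integral_distr; simp)+
  have 2: "(LINT x|?N1. ?i x) = (LINT \<omega>|M1. ?i (X1 \<omega>) + f1 \<omega> * ?i (X1 \<omega>))"
    "(LINT x|?N2. ?i x) = (LINT \<omega>|M2. ?i (X2 \<omega>) + f2 \<omega> * ?i (X2 \<omega>))"
    using pos by (subst integral_distr; simp add: integral_density distrib_right)+
  show ?thesis
    using 1 2 i unfolding D N by simp
qed

text \<open>Induction on the coordinates. Restricting both measures to the event that
  \<open>X j\<close> lies in \<open>A j\<close> leaves a claim about the remaining coordinates for
  new measures, hence \<open>arbitrary: M1 M2\<close>. The induction hypothesis needs equal
  characteristic functions under these restrictions. For fixed frequencies on \<open>I\<close> they
  are integrals of a cosine and a sine against the indicator of \<open>X j\<close>, which is the
  situation of the preceding lemma.\<close>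

lemma measure_finite_dim_eqI_char:
  fixes X1 :: "'i \<Rightarrow> 'a \<Rightarrow> real" and X2 :: "'i \<Rightarrow> 'b \<Rightarrow> real"
  assumes "finite I" "finite_measure M1" "finite_measure M2"
    and "\<And>i. i \<in> I \<Longrightarrow> X1 i \<in> borel_measurable M1" "\<And>i. i \<in> I \<Longrightarrow> X2 i \<in> borel_measurable M2"
    and "\<And>u. (CLINT \<omega>|M1. iexp (\<Sum>i\<in>I. u i * X1 i \<omega>)) = (CLINT \<omega>|M2. iexp (\<Sum>i\<in>I. u i * X2 i \<omega>))"
    and "\<And>i. i \<in> I \<Longrightarrow> A i \<in> sets borel"
  shows "measure M1 {\<omega>\<in>space M1. \<forall>i\<in>I. X1 i \<omega> \<in> A i} = measure M2 {\<omega>\<in>space M2. \<forall>i\<in>I. X2 i \<omega> \<in> A i}"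
  using assms
proof (induction I arbitrary: M1 M2 rule: finite_induct)
  case empty
  show ?case using empty.prems(5)[of "\<lambda>_. 0"] by simp
next
  case (insert j I)
  interpret M1: finite_measure M1 by fact
  interpret M2: finite_measure M2 by fact
  have [measurable]: "X1 j \<in> borel_measurable M1" "X2 j \<in> borel_measurable M2" "A j \<in> sets borel"
    using insert.prems by auto
  have XI[measurable]: "\<And>i. i \<in> I \<Longrightarrow> X1 i \<in> borel_measurable M1" "\<And>i. i \<in> I \<Longrightarrow> X2 i \<in> borel_measurable M2"
    and A[measurable]: "\<And>i. i \<in> I \<Longrightarrow> A i \<in> sets borel"
    using insert.prems by auto
  have fin[simp]: "finite I" by fact
  have full: "(CLINT \<omega>|M1. iexp ((\<Sum>i\<in>I. u i * X1 i \<omega>) + t * X1 j \<omega>)) =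
      (CLINT \<omega>|M2. iexp ((\<Sum>i\<in>I. u i * X2 i \<omega>) + t * X2 j \<omega>))" for u t
  proof -
    have "(\<Sum>i\<in>insert j I. (u(j:=t)) i * Y i) = (\<Sum>i\<in>I. u i * Y i) + t * Y j" for Y :: "'i \<Rightarrow> real"
      using insert.hyps by (auto simp: add.commute intro!: sum.cong)
    from this[of "\<lambda>i. X1 i _"] this[of "\<lambda>i. X2 i _"] show ?thesis using insert.prems(5)[of "u(j:=t)"] by presburger
  qed
  define N1 where "N1 = density M1 (\<lambda>\<omega>. ennreal (indicator (A j) (X1 j \<omega>)))"
  define N2 where "N2 = density M2 (\<lambda>\<omega>. ennreal (indicator (A j) (X2 j \<omega>)))"
  have eq0: "(CLINT \<omega>|M1. iexp (t * X1 j \<omega>)) = (CLINT \<omega>|M2. iexp (t * X2 j \<omega>))" for t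
    using full[of "\<lambda>_. 0" t] by simp
  have *: "(CLINT \<omega>|N1. iexp (\<Sum>i\<in>I. u i * X1 i \<omega>)) = (CLINT \<omega>|N2. iexp (\<Sum>i\<in>I. u i * X2 i \<omega>))" for u
  proof -
    define \<theta>1 where "\<theta>1 \<omega> = (\<Sum>i\<in>I. u i * X1 i \<omega>)" for \<omega>
    define \<theta>2 where "\<theta>2 \<omega> = (\<Sum>i\<in>I. u i * X2 i \<omega>)" for \<omega>
    have [measurable]: "\<theta>1 \<in> borel_measurable M1" "\<theta>2 \<in> borel_measurable M2"
      unfolding \<theta>1_def \<theta>2_def by measurable
    have F: "(CLINT \<omega>|M1. iexp (s * \<theta>1 \<omega> + t * X1 j \<omega>)) = (CLINT \<omega>|M2. iexp (s * \<theta>2 \<omega> + t * X2 j \<omega>))" for s t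
      using full[of "\<lambda>i. s * u i" t] by (simp add: \<theta>1_def \<theta>2_def sum_distrib_left mult.assoc)
    have I: "integrable M1 (\<lambda>\<omega>. iexp (s * \<theta>1 \<omega> + t * X1 j \<omega>))"
      "integrable M2 (\<lambda>\<omega>. iexp (s * \<theta>2 \<omega> + t * X2 j \<omega>))" for s t
      by (auto intro!: M1.integrable_const_bound[of _ 1] M2.integrable_const_bound[of _ 1])
    \<comment> \<open>Product-to-sum formulas reduce the weighted characteristic functions to joint
      ones. The factors \<open>1 * x\<close> and \<open>(-1) * x\<close> stay visible so that
      \<open>I\<close> and \<open>F\<close> apply with \<open>s\<close> equal to 1 and -1.\<close>
    have c: "complex_of_real (cos x) * iexp y = (iexp (1 * x + y) + iexp ((-1) * x + y)) / 2" for x y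
    proof -
      have "iexp (1 * x + y) + iexp ((-1) * x + y) = 2 * (complex_of_real (cos x) * iexp y)"
        by (simp add: complex_eq_iff Re_exp Im_exp)
          (simp add: sin_diff cos_diff sin_add cos_add algebra_simps)
      then show ?thesis by simp
    qed
    have s: "complex_of_real (sin x) * iexp y = (iexp (1 * x + y) - iexp ((-1) * x + y)) / (2 * \<i>)" for x y
    proof -
      have "iexp (1 * x + y) - iexp ((-1) * x + y) = 2 * \<i> * (complex_of_real (sin x) * iexp y)"
        by (simp add: complex_eq_iff Re_exp Im_exp)
          (simp add: sin_diff cos_diff sin_add cos_add algebra_simps)
      then show ?thesis by simp
    qed
    have C: "(LINT \<omega>|M1. cos (\<theta>1 \<omega>) * indicator (A j) (X1 j \<omega>)) = (LINT \<omega>|M2. cos (\<theta>2 \<omega>) * indicator (A j) (X2 j \<omega>))"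
      using I F by (intro weighted_integral_indicator_eqI_char eq0 insert.prems(1,2)) 
        (simp_all only: c integral_divide_zero Bochner_Integration.integral_add I F, simp_all)
    have S: "(LINT \<omega>|M1. sin (\<theta>1 \<omega>) * indicator (A j) (X1 j \<omega>)) = (LINT \<omega>|M2. sin (\<theta>2 \<omega>) * indicator (A j) (X2 j \<omega>))"
      using I F by (intro weighted_integral_indicator_eqI_char eq0 insert.prems(1,2)) 
        (simp_all only: s integral_divide_zero Bochner_Integration.integral_diff I F, simp_all)
    have e1: "(CLINT \<omega>|N1. iexp (\<theta>1 \<omega>)) = Complex (LINT \<omega>|M1. cos (\<theta>1 \<omega>) * indicator (A j) (X1 j \<omega>)) (LINT \<omega>|M1. sin (\<theta>1 \<omega>) * indicator (A j) (X1 j \<omega>))"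
    proof -
      have i: "integrable M1 (\<lambda>\<omega>. (indicator (A j) (X1 j \<omega>) :: real) *\<^sub>R iexp (\<theta>1 \<omega>))"
        by (auto intro!: M1.integrable_const_bound[of _ 1] split: split_indicator)
      have "(CLINT \<omega>|N1. iexp (\<theta>1 \<omega>)) = (CLINT \<omega>|M1. (indicator (A j) (X1 j \<omega>) :: real) *\<^sub>R iexp (\<theta>1 \<omega>))"
        unfolding N1_def by (subst integral_density) auto
      then show ?thesis
        using i by (simp add: complex_eq_iff Re_exp Im_exp mult.commute flip: integral_Re integral_Im)
    qed
    have e2: "(CLINT \<omega>|N2. iexp (\<theta>2 \<omega>)) = Complex (LINT \<omega>|M2. cos (\<theta>2 \<omega>) * indicator (A j) (X2 j \<omega>)) (LINT \<omega>|M2. sin (\<theta>2 \<omega>) * indicator (A j) (X2 j \<omega>))"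
    proof -
      have i: "integrable M2 (\<lambda>\<omega>. (indicator (A j) (X2 j \<omega>) :: real) *\<^sub>R iexp (\<theta>2 \<omega>))"
        by (auto intro!: M2.integrable_const_bound[of _ 1] split: split_indicator)
      have "(CLINT \<omega>|N2. iexp (\<theta>2 \<omega>)) = (CLINT \<omega>|M2. (indicator (A j) (X2 j \<omega>) :: real) *\<^sub>R iexp (\<theta>2 \<omega>))"
        unfolding N2_def by (subst integral_density) auto
      then show ?thesis
        using i by (simp add: complex_eq_iff Re_exp Im_exp mult.commute flip: integral_Re integral_Im)
    qed
    show ?thesis using e1 e2 C S by (simp add: \<theta>1_def \<theta>2_def)
  qed
  have fN: "finite_measure N1" "finite_measure N2"
    unfolding N1_def N2_def
    by (auto intro!: finite_measureI simp: emeasure_density nn_integral_eq_integral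
      M1.integrable_const_bound[of _ 1] M2.integrable_const_bound[of _ 1])
  have "measure N1 {\<omega>\<in>space N1. \<forall>i\<in>I. X1 i \<omega> \<in> A i} = measure N2 {\<omega>\<in>space N2. \<forall>i\<in>I. X2 i \<omega> \<in> A i}"
    using * fN XI A by (intro insert.IH) (auto simp: N1_def N2_def)
  moreover have "measure N1 {\<omega>\<in>space N1. \<forall>i\<in>I. X1 i \<omega> \<in> A i} = measure M1 {\<omega>\<in>space M1. \<forall>i\<in>insert j I. X1 i \<omega> \<in> A i}"
  proof -
    have "{\<omega>\<in>space M1. \<forall>i\<in>I. X1 i \<omega> \<in> A i} \<in> sets M1" by measurable
    then have "emeasure N1 {\<omega>\<in>space N1. \<forall>i\<in>I. X1 i \<omega> \<in> A i} = (\<integral>\<^sup>+\<omega>. indicator {\<omega>\<in>space M1. \<forall>i\<in>insert j I. X1 i \<omega> \<in> A i} \<omega> \<partial>M1)"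
      unfolding N1_def 
      by (subst emeasure_density; (intro nn_integral_cong)?; auto split: split_indicator)
    then show ?thesis by (subst (asm) nn_integral_indicator) (auto simp: measure_def)
  qed
  moreover have "measure N2 {\<omega>\<in>space N2. \<forall>i\<in>I. X2 i \<omega> \<in> A i} = measure M2 {\<omega>\<in>space M2. \<forall>i\<in>insert j I. X2 i \<omega> \<in> A i}"
  proof -
    have "{\<omega>\<in>space M2. \<forall>i\<in>I. X2 i \<omega> \<in> A i} \<in> sets M2" by measurable
    then have "emeasure N2 {\<omega>\<in>space N2. \<forall>i\<in>I. X2 i \<omega> \<in> A i} = (\<integral>\<^sup>+\<omega>. indicator {\<omega>\<in>space M2. \<forall>i\<in>insert j I. X2 i \<omega> \<in> A i} \<omega> \<partial>M2)"
      unfolding N2_def 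
      by (subst emeasure_density; (intro nn_integral_cong)?; auto split: split_indicator)
    then show ?thesis by (subst (asm) nn_integral_indicator) (auto simp: measure_def)
  qed
  ultimately show ?case by simp
qed

text \<open>Measurable rectangles form an intersection-stable generator of the product
  sigma-algebra, and on them the laws agree by the preceding lemma. The constant sequence of the
  whole space, of finite mass, is the required exhaustion.\<close>

lemma distr_PiM_eqI_char:
  fixes X1 :: "'i \<Rightarrow> 'a \<Rightarrow> real" and X2 :: "'i \<Rightarrow> 'b \<Rightarrow> real"
  assumes I: "finite I" and fin: "finite_measure M1" "finite_measure M2"
    and X: "\<And>i. i \<in> I \<Longrightarrow> X1 i \<in> borel_measurable M1" "\<And>i. i \<in> I \<Longrightarrow> X2 i \<in> borel_measurable M2"
    and char: "\<And>u. (CLINT \<omega>|M1. iexp (\<Sum>i\<in>I. u i * X1 i \<omega>)) = (CLINT \<omega>|M2. iexp (\<Sum>i\<in>I. u i * X2 i \<omega>))"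
  shows "distr M1 (PiM I (\<lambda>_. borel)) (\<lambda>\<omega>. \<lambda>i\<in>I. X1 i \<omega>) = distr M2 (PiM I (\<lambda>_. borel)) (\<lambda>\<omega>. \<lambda>i\<in>I. X2 i \<omega>)"
    (is "?D1 = ?D2")
proof -
  interpret M1: finite_measure M1 by fact
  interpret M2: finite_measure M2 by fact
  have m[measurable]: "(\<lambda>\<omega>. \<lambda>i\<in>I. X1 i \<omega>) \<in> M1 \<rightarrow>\<^sub>M PiM I (\<lambda>_. borel)" "(\<lambda>\<omega>. \<lambda>i\<in>I. X2 i \<omega>) \<in> M2 \<rightarrow>\<^sub>M PiM I (\<lambda>_. borel)"
    using X by measurable
  interpret D1: finite_measure ?D1 by (rule M1.finite_measure_distr) measurable
  show ?thesis
  proof (rule measure_eqI_PiM_finite[where A = "\<lambda>_. \<Pi>\<^sub>E i\<in>I. UNIV"])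
    fix A :: "'i \<Rightarrow> real set" assume A: "\<And>i. i \<in> I \<Longrightarrow> A i \<in> sets borel"
    then have s: "Pi\<^sub>E I A \<in> sets (PiM I (\<lambda>_. borel))" using I by (intro sets_PiM_I_finite) auto
    have "(\<lambda>\<omega>. \<lambda>i\<in>I. X1 i \<omega>) -` Pi\<^sub>E I A \<inter> space M1 = {\<omega>\<in>space M1. \<forall>i\<in>I. X1 i \<omega> \<in> A i}"
      "(\<lambda>\<omega>. \<lambda>i\<in>I. X2 i \<omega>) -` Pi\<^sub>E I A \<inter> space M2 = {\<omega>\<in>space M2. \<forall>i\<in>I. X2 i \<omega> \<in> A i}"
      by auto
    then show "emeasure ?D1 (Pi\<^sub>E I A) = emeasure ?D2 (Pi\<^sub>E I A)"
      using measure_finite_dim_eqI_char[of I M1 M2 X1 X2 A, OF I fin X char A] s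
      by (simp add: emeasure_distr M1.emeasure_eq_measure M2.emeasure_eq_measure)
  next
    show "range (\<lambda>_. \<Pi>\<^sub>E i\<in>I. UNIV) \<subseteq> prod_algebra I (\<lambda>_. borel :: real measure)"
      using I by (auto intro!: prod_algebraI_finite)
    show "emeasure ?D1 (\<Pi>\<^sub>E i\<in>I. UNIV) \<noteq> \<infinity>" for i :: nat
      using D1.emeasure_finite by simp
  qed (use I in \<open>auto simp: space_PiM\<close>)
qed

section \<open>Gaussian variables\<close>

lemma char_normal_density:
  assumes "\<sigma> > 0"
  shows "(CLBINT x. normal_density \<mu> \<sigma> x *\<^sub>R iexp (t * x)) = iexp (t * \<mu>) * exp (- (\<sigma> * t)\<^sup>2 / 2)"
proof -
  have "(CLBINT x. normal_density \<mu> \<sigma> x *\<^sub>R iexp (t * x)) =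
      \<bar>\<sigma>\<bar> *\<^sub>R (CLBINT x. normal_density \<mu> \<sigma> (\<mu> + \<sigma> * x) *\<^sub>R iexp (t * (\<mu> + \<sigma> * x)))"
    using assms by (intro lborel_integral_real_affine) auto
  also have "\<dots> = (CLBINT x. iexp (t * \<mu>) * (std_normal_density x *\<^sub>R iexp ((\<sigma> * t) * x)))"
    using assms unfolding integral_scaleR_right[symmetric]
    by (intro Bochner_Integration.integral_cong refl)
      (simp add: normal_density_def real_sqrt_mult scaleR_conv_of_real power_mult_distrib
        exp_add[symmetric] field_simps)
  also have "\<dots> = iexp (t * \<mu>) * char std_normal_distribution (\<sigma> * t)"
    by (simp only: char_def integral_mult_right_zero) (simp add: integral_density)
  finally show ?thesis by (simp add: char_std_normal_distribution)
qed

text \<open>Completing the square. This is the Cameron-Martin shift in dimension one: the tilt moves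
  the mean from 0 to the variance. Both the exponential moment and the tilted characteristic
  function rest on it.\<close>

lemma normal_density_exp_tilt:
  "\<sigma> > 0 \<Longrightarrow> normal_density 0 \<sigma> x * exp (x - \<sigma>\<^sup>2 / 2) = normal_density (\<sigma>\<^sup>2) \<sigma> x"
  by (simp add: normal_density_def exp_add[symmetric] field_simps power2_eq_square)

context prob_space
begin

text \<open>Constants count as Gaussian but have no density, so the moments and transforms below are
  computed separately in the two cases. The resulting formulas agree because they are expressed
  through \<open>variance X\<close>, which is 0 in the degenerate case.\<close>

lemma centered_gaussian_cases:
  assumes X: "gaussian_rv M X" and X0: "expectation X = 0"
  obtains "AE \<omega> in M. X \<omega> = 0" "variance X = 0"
  | "variance X > 0" "distributed M lborel X (\<lambda>x. ennreal (normal_density 0 (sqrt (variance X)) x))"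
proof -
  have [measurable]: "X \<in> borel_measurable M" using X by (simp add: gaussian_rv_def)
  consider (const) \<mu> where "AE \<omega> in M. X \<omega> = \<mu>"
    | (normal) \<mu> \<sigma> where "\<sigma> > 0" "distributed M lborel X (\<lambda>x. ennreal (normal_density \<mu> \<sigma> x))"
    using X unfolding gaussian_rv_def by blast
  then show thesis
  proof cases
    case const
    then have "expectation X = expectation (\<lambda>_. \<mu>)" by (intro integral_cong_AE) auto
    then have "\<mu> = 0" using X0 by (simp add: prob_space)
    then have 1: "AE \<omega> in M. X \<omega> = 0" using const by simp
    then have "variance X = expectation (\<lambda>_. 0)" unfolding X0 by (intro integral_cong_AE) auto
    then show thesis using 1 that(1) by simp
  next
    case normal
    have "\<mu> = 0" using normal_distributed_expectation[OF normal] X0 by simp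
    moreover have v: "variance X = \<sigma>\<^sup>2" using normal_distributed_variance[OF normal] by simp
    ultimately show thesis using normal that(2) by (simp add: v real_sqrt_abs)
  qed
qed

lemma centered_gaussian_moments:
  assumes X: "gaussian_rv M X" and X0: "expectation X = 0"
  shows "integrable M X" and "integrable M (\<lambda>\<omega>. (X \<omega>)\<^sup>2)"
proof -
  have [measurable]: "X \<in> borel_measurable M" using X by (simp add: gaussian_rv_def)
  have "integrable M X \<and> integrable M (\<lambda>\<omega>. (X \<omega>)\<^sup>2)"
    using X X0
  proof (cases rule: centered_gaussian_cases)
    case 1
    have "integrable M X \<longleftrightarrow> integrable M (\<lambda>_. 0 :: real)"
      by (rule integrable_cong_AE) (use 1 in auto)
    moreover have "integrable M (\<lambda>\<omega>. (X \<omega>)\<^sup>2) \<longleftrightarrow> integrable M (\<lambda>_. 0 :: real)"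
      by (rule integrable_cong_AE) (use 1 in auto)
    ultimately show ?thesis by simp
  next
    case 2
    then show ?thesis
      using distributed_integrable[OF 2(2), of "\<lambda>x. x"] distributed_integrable[OF 2(2), of "\<lambda>x. x\<^sup>2"]
        integrable_normal_moment[of "sqrt (variance X)" 0 1]
        integrable_normal_moment[of "sqrt (variance X)" 0 2]
      by simp
  qed
  then show "integrable M X" "integrable M (\<lambda>\<omega>. (X \<omega>)\<^sup>2)" by auto
qed

lemma centered_gaussian_mgf:
  assumes X: "gaussian_rv M X" and X0: "expectation X = 0"
  shows "integrable M (\<lambda>\<omega>. exp (X \<omega>))" and "expectation (\<lambda>\<omega>. exp (X \<omega>)) = exp (variance X / 2)"
proof -
  have [measurable]: "X \<in> borel_measurable M" using X by (simp add: gaussian_rv_def)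
  have "integrable M (\<lambda>\<omega>. exp (X \<omega>)) \<and> expectation (\<lambda>\<omega>. exp (X \<omega>)) = exp (variance X / 2)"
    using X X0
  proof (cases rule: centered_gaussian_cases)
    case 1
    have "integrable M (\<lambda>\<omega>. exp (X \<omega>)) \<longleftrightarrow> integrable M (\<lambda>_. 1 :: real)"
      by (rule integrable_cong_AE) (use 1 in auto)
    moreover have "expectation (\<lambda>\<omega>. exp (X \<omega>)) = expectation (\<lambda>_. 1)"
      by (rule integral_cong_AE) (use 1 in auto)
    ultimately show ?thesis using 1(2) by (simp add: prob_space)
  next
    case 2
    define \<sigma> where "\<sigma> = sqrt (variance X)"
    have \<sigma>: "\<sigma> > 0" "\<sigma>\<^sup>2 = variance X" using 2(1) by (auto simp: \<sigma>_def)
    note d = 2(2)[folded \<sigma>_def]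
    have *: "normal_density 0 \<sigma> x * exp x = exp (\<sigma>\<^sup>2 / 2) * normal_density (\<sigma>\<^sup>2) \<sigma> x" for x
      unfolding normal_density_exp_tilt[OF \<sigma>(1), of x, symmetric] by (simp add: exp_diff)
    have "integrable M (\<lambda>\<omega>. exp (X \<omega>))"
      using distributed_integrable[OF d, of exp] \<sigma>(1) by (simp add: *)
    moreover have "expectation (\<lambda>\<omega>. exp (X \<omega>)) = exp (\<sigma>\<^sup>2 / 2)"
      using distributed_integral[OF d, of exp] \<sigma>(1) by (simp add: *)
    ultimately show ?thesis using \<sigma> by simp
  qed
  then show "integrable M (\<lambda>\<omega>. exp (X \<omega>))" "expectation (\<lambda>\<omega>. exp (X \<omega>)) = exp (variance X / 2)" by auto
qed

lemma normal_distributed_expectation_complex: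
  fixes g :: "real \<Rightarrow> complex"
  assumes \<sigma>: "\<sigma> > 0" and d: "distributed M lborel X (\<lambda>x. ennreal (normal_density \<mu> \<sigma> x))"
    and [measurable]: "g \<in> borel_measurable borel"
  shows "(CLINT \<omega>|M. g (X \<omega>)) = (CLBINT x. normal_density \<mu> \<sigma> x *\<^sub>R g x)"
proof -
  have [measurable]: "X \<in> M \<rightarrow>\<^sub>M lborel" using d distributed_measurable by blast
  then have [measurable]: "random_variable borel X" by simp
  have "(CLINT \<omega>|M. g (X \<omega>)) = (CLINT x|distr M lborel X. g x)"
    by (rule integral_distr[symmetric]) auto
  also have "distr M lborel X = density lborel (\<lambda>x. ennreal (normal_density \<mu> \<sigma> x))"
    using d by (simp add: distributed_def)
  also have "(CLINT x|density lborel (\<lambda>x. ennreal (normal_density \<mu> \<sigma> x)). g x) =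
      (CLBINT x. normal_density \<mu> \<sigma> x *\<^sub>R g x)"
    by (rule integral_density) auto
  finally show ?thesis .
qed

lemma centered_gaussian_char:
  assumes X: "gaussian_rv M X" and X0: "expectation X = 0"
  shows "(CLINT \<omega>|M. iexp (X \<omega>)) = exp (- variance X / 2)"
proof -
  have [measurable]: "X \<in> borel_measurable M" using X by (simp add: gaussian_rv_def)
  show ?thesis
    using X X0
  proof (cases rule: centered_gaussian_cases)
    case 1
    have "(CLINT \<omega>|M. iexp (X \<omega>)) = (CLINT \<omega>|M. 1)"
      by (rule integral_cong_AE) (use 1 in auto)
    then show ?thesis using 1(2) by (simp add: prob_space)
  next
    case 2
    then show ?thesis
      using normal_distributed_expectation_complex[OF _ 2(2), of iexp]
        char_normal_density[of "sqrt (variance X)" 0 1] by (simp del: of_real_exp)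
  qed
qed

text \<open>The right side is the characteristic function at \<open>c\<close> of a normal law whose
  mean and variance both equal \<open>variance X\<close>.\<close>

lemma centered_gaussian_tilted_char:
  assumes X: "gaussian_rv M X" and X0: "expectation X = 0"
  shows "(CLINT \<omega>|M. exp (X \<omega> - variance X / 2) *\<^sub>R iexp (c * X \<omega>)) =
    iexp (c * variance X) * exp (- c\<^sup>2 * variance X / 2)"
proof -
  have [measurable]: "X \<in> borel_measurable M" using X by (simp add: gaussian_rv_def)
  show ?thesis
    using X X0
  proof (cases rule: centered_gaussian_cases)
    case 1
    have "(CLINT \<omega>|M. exp (X \<omega> - variance X / 2) *\<^sub>R iexp (c * X \<omega>)) = (CLINT \<omega>|M. 1)"
      by (rule integral_cong_AE) (use 1 in auto)
    then show ?thesis using 1(2) by (simp add: prob_space)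
  next
    case 2
    define \<sigma> where "\<sigma> = sqrt (variance X)"
    have \<sigma>: "\<sigma> > 0" "\<sigma>\<^sup>2 = variance X" using 2(1) by (auto simp: \<sigma>_def)
    note d = 2(2)[folded \<sigma>_def]
    have "(CLINT \<omega>|M. exp (X \<omega> - \<sigma>\<^sup>2 / 2) *\<^sub>R iexp (c * X \<omega>)) =
        (CLBINT x. normal_density 0 \<sigma> x *\<^sub>R (exp (x - \<sigma>\<^sup>2 / 2) *\<^sub>R iexp (c * x)))"
      by (rule normal_distributed_expectation_complex[OF \<sigma>(1) d]) measurable
    also have "\<dots> = (CLBINT x. normal_density (\<sigma>\<^sup>2) \<sigma> x *\<^sub>R iexp (c * x))"
      by (simp only: scaleR_scaleR normal_density_exp_tilt[OF \<sigma>(1)])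
    also have "\<dots> = iexp (c * \<sigma>\<^sup>2) * exp (- (\<sigma> * c)\<^sup>2 / 2)"
      by (rule char_normal_density[OF \<sigma>(1)])
    finally show ?thesis by (simp add: \<sigma>(2) power_mult_distrib mult.commute)
  qed
qed

section \<open>Jointly Gaussian pairs: covariance, independence, exponential tilting\<close>

lemma integrable_mult_of_squares:
  fixes X Y :: "'a \<Rightarrow> real"
  assumes [measurable]: "X \<in> borel_measurable M" "Y \<in> borel_measurable M"
    and int: "integrable M (\<lambda>\<omega>. (X \<omega>)\<^sup>2)" "integrable M (\<lambda>\<omega>. (Y \<omega>)\<^sup>2)"
  shows "integrable M (\<lambda>\<omega>. X \<omega> * Y \<omega>)"
proof (rule Bochner_Integration.integrable_bound)
  show "integrable M (\<lambda>\<omega>. (X \<omega>)\<^sup>2 + (Y \<omega>)\<^sup>2)" using int by simp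
  have "\<bar>x * y\<bar> \<le> x\<^sup>2 + y\<^sup>2" for x y :: real
    using zero_le_power2[of "\<bar>x\<bar> - \<bar>y\<bar>"] mult_nonneg_nonneg[OF abs_ge_zero[of x] abs_ge_zero[of y]]
    unfolding power2_diff power2_abs abs_mult by linarith
  then show "AE \<omega> in M. norm (X \<omega> * Y \<omega>) \<le> norm ((X \<omega>)\<^sup>2 + (Y \<omega>)\<^sup>2)"
    by (auto intro!: AE_I2)
qed measurable

lemma variance_lincomb:
  fixes X Y :: "'a \<Rightarrow> real"
  assumes int: "integrable M X" "integrable M Y" "integrable M (\<lambda>\<omega>. (X \<omega>)\<^sup>2)" "integrable M (\<lambda>\<omega>. (Y \<omega>)\<^sup>2)"
    and "expectation X = 0" "expectation Y = 0"
  shows "expectation (\<lambda>\<omega>. a * X \<omega> + b * Y \<omega>) = 0"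
    and "variance (\<lambda>\<omega>. a * X \<omega> + b * Y \<omega>) =
      a\<^sup>2 * variance X + 2 * a * b * expectation (\<lambda>\<omega>. X \<omega> * Y \<omega>) + b\<^sup>2 * variance Y"
proof -
  have [measurable]: "X \<in> borel_measurable M" "Y \<in> borel_measurable M" using int by auto
  note [simp] = integrable_mult_of_squares[OF \<open>X \<in> borel_measurable M\<close> \<open>Y \<in> borel_measurable M\<close> int(3,4)]
  show 0: "expectation (\<lambda>\<omega>. a * X \<omega> + b * Y \<omega>) = 0" using assms by simp
  have "variance (\<lambda>\<omega>. a * X \<omega> + b * Y \<omega>) =
    expectation (\<lambda>\<omega>. a\<^sup>2 * (X \<omega>)\<^sup>2 + 2 * a * b * (X \<omega> * Y \<omega>) + b\<^sup>2 * (Y \<omega>)\<^sup>2)"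
    unfolding 0 by (intro Bochner_Integration.integral_cong refl) (simp add: power2_eq_square algebra_simps)
  then show "variance (\<lambda>\<omega>. a * X \<omega> + b * Y \<omega>) =
      a\<^sup>2 * variance X + 2 * a * b * expectation (\<lambda>\<omega>. X \<omega> * Y \<omega>) + b\<^sup>2 * variance Y"
    using assms by simp
qed

text \<open>Without the cross term the joint characteristic function factorises, so it is also that
  of the pair \<open>X (fst p)\<close>, \<open>Y (snd p)\<close> on the product space, whose
  components are independent. Uniqueness of joint laws, with \<open>bool\<close> as the index set of
  the two coordinates, then gives the product formula on rectangles.\<close>

lemma uncorrelated_gaussian_indep_var:
  assumes g: "\<And>a b. gaussian_rv M (\<lambda>\<omega>. a * X \<omega> + b * Y \<omega>)"
    and X0: "expectation X = 0" and Y0: "expectation Y = 0"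
    and XY: "expectation (\<lambda>\<omega>. X \<omega> * Y \<omega>) = 0"
  shows "indep_var borel X borel Y"
proof -
  have gX: "gaussian_rv M X" and gY: "gaussian_rv M Y" using g[of 1 0] g[of 0 1] by simp_all
  then have [measurable]: "X \<in> borel_measurable M" "Y \<in> borel_measurable M" by (auto simp: gaussian_rv_def)
  note int = centered_gaussian_moments(1)[OF gX X0] centered_gaussian_moments(1)[OF gY Y0]
    centered_gaussian_moments(2)[OF gX X0] centered_gaussian_moments(2)[OF gY Y0]
  note vl = variance_lincomb[OF int X0 Y0]
  have ch: "(CLINT \<omega>|M. iexp (a * X \<omega> + b * Y \<omega>)) = exp (- (a\<^sup>2 * variance X + b\<^sup>2 * variance Y) / 2)" for a b
    using centered_gaussian_char[OF g vl(1), of a b] unfolding vl(2) XY by simp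
  interpret P: pair_prob_space M M ..
  have rect: "prob {\<omega>\<in>space M. X \<omega> \<in> A \<and> Y \<omega> \<in> B} = prob {\<omega>\<in>space M. X \<omega> \<in> A} * prob {\<omega>\<in>space M. Y \<omega> \<in> B}"
    if [measurable]: "A \<in> sets borel" "B \<in> sets borel" for A B
  proof -
    let ?X1 = "\<lambda>i. if i then X else Y"
    let ?X2 = "\<lambda>i (p :: 'a \<times> 'a). if i then X (fst p) else Y (snd p)"
    let ?A = "\<lambda>i. if i then A else B"
    have "measure M {\<omega>\<in>space M. \<forall>i\<in>UNIV. ?X1 i \<omega> \<in> ?A i} =
      measure (M \<Otimes>\<^sub>M M) {p\<in>space (M \<Otimes>\<^sub>M M). \<forall>i\<in>UNIV. ?X2 i p \<in> ?A i}"
    proof (rule measure_finite_dim_eqI_char)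
      fix u :: "bool \<Rightarrow> real"
      have "(CLINT p|M \<Otimes>\<^sub>M M. iexp (\<Sum>i\<in>UNIV. u i * ?X2 i p)) =
        (CLINT p|M \<Otimes>\<^sub>M M. (case p of (x, y) \<Rightarrow> iexp (u True * X x) * iexp (u False * Y y)))"
        by (intro Bochner_Integration.integral_cong refl)
          (auto simp: UNIV_bool exp_add[symmetric] algebra_simps split: prod.split)
      also have "\<dots> = (CLINT x|M. CLINT y|M. iexp (u True * X x) * iexp (u False * Y y))"
      proof -
        have "integrable (M \<Otimes>\<^sub>M M) (\<lambda>(x, y). iexp (u True * X x) * iexp (u False * Y y))"
          by (intro P.integrable_const_bound[of _ 1]) (auto simp: norm_mult)
        from P.integral_fst'[OF this] show ?thesis by simp
      qed
      also have "\<dots> = (CLINT x|M. iexp (u True * X x)) * (CLINT y|M. iexp (u False * Y y))"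
        by simp
      also have "\<dots> = exp (- ((u True)\<^sup>2 * variance X + (u False)\<^sup>2 * variance Y) / 2)"
        using ch[of "u True" 0] ch[of 0 "u False"]
        by (simp add: exp_add[symmetric] add_divide_distrib diff_divide_distrib del: of_real_exp flip: of_real_mult)
      also have "\<dots> = (CLINT \<omega>|M. iexp (\<Sum>i\<in>UNIV. u i * ?X1 i \<omega>))"
        using ch[of "u True" "u False"] by (simp add: UNIV_bool add.commute)
      finally show "(CLINT \<omega>|M. iexp (\<Sum>i\<in>UNIV. u i * ?X1 i \<omega>)) =
        (CLINT p|M \<Otimes>\<^sub>M M. iexp (\<Sum>i\<in>UNIV. u i * ?X2 i p))" by simp
    qed (auto intro: finite_measure_axioms P.finite_measure_axioms)
    also have "{p\<in>space (M \<Otimes>\<^sub>M M). \<forall>i\<in>UNIV. ?X2 i p \<in> ?A i} =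
        {\<omega>\<in>space M. X \<omega> \<in> A} \<times> {\<omega>\<in>space M. Y \<omega> \<in> B}"
      by (auto simp: space_pair_measure UNIV_bool)
    finally show ?thesis by (simp add: all_bool_eq measure_def emeasure_pair_measure_Times enn2real_mult conj_commute)
  qed
  show ?thesis
    unfolding indep_var_distribution_eq
  proof (intro conjI pair_measure_eqI)
    fix A B assume "A \<in> sets (distr M borel X)" "B \<in> sets (distr M borel Y)"
    then have [measurable]: "A \<in> sets borel" "B \<in> sets borel" by auto
    have "(\<lambda>\<omega>. (X \<omega>, Y \<omega>)) -` (A \<times> B) \<inter> space M = {\<omega>\<in>space M. X \<omega> \<in> A \<and> Y \<omega> \<in> B}"
      "X -` A \<inter> space M = {\<omega>\<in>space M. X \<omega> \<in> A}" "Y -` B \<inter> space M = {\<omega>\<in>space M. Y \<omega> \<in> B}" by auto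
    then show "emeasure (distr M borel X) A * emeasure (distr M borel Y) B =
      emeasure (distr M (borel \<Otimes>\<^sub>M borel) (\<lambda>\<omega>. (X \<omega>, Y \<omega>))) (A \<times> B)"
      by (simp add: emeasure_distr emeasure_eq_measure rect ennreal_mult[symmetric])
  qed (auto intro!: finite_measure.sigma_finite_measure finite_measure_distr)
qed

text \<open>The proof splits X into a multiple of Y and a remainder independent of Y.\<close>
lemma gaussian_exponential_tilt_char:
  assumes g: "\<And>a b. gaussian_rv M (\<lambda>\<omega>. a * X \<omega> + b * Y \<omega>)"
    and X0: "expectation X = 0" and Y0: "expectation Y = 0"
  shows "(CLINT \<omega>|M. exp (Y \<omega> - variance Y / 2) *\<^sub>R iexp (X \<omega>)) =
    iexp (expectation (\<lambda>\<omega>. X \<omega> * Y \<omega>)) * exp (- variance X / 2)"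
proof -
  have gX: "gaussian_rv M X" and gY: "gaussian_rv M Y" using g[of 1 0] g[of 0 1] by simp_all
  then have [measurable]: "X \<in> borel_measurable M" "Y \<in> borel_measurable M" by (auto simp: gaussian_rv_def)
  note int = centered_gaussian_moments(1)[OF gX X0] centered_gaussian_moments(1)[OF gY Y0]
    centered_gaussian_moments(2)[OF gX X0] centered_gaussian_moments(2)[OF gY Y0]
  note vl = variance_lincomb[OF int X0 Y0]
  define v where "v = variance Y"
  define k where "k = expectation (\<lambda>\<omega>. X \<omega> * Y \<omega>)"
  show ?thesis
  \<comment> \<open>The regression coefficient of the second case divides by \<open>v\<close>. If
    \<open>v\<close> is 0, then \<open>Y\<close> vanishes almost surely and the tilt is
    trivial.\<close>
  proof (cases "v = 0")
    case True
    have Y: "AE \<omega> in M. Y \<omega> = 0"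
      using gY Y0 by (cases rule: centered_gaussian_cases) (use True in \<open>auto simp: v_def\<close>)
    then have "expectation (\<lambda>\<omega>. X \<omega> * Y \<omega>) = expectation (\<lambda>_. 0)"
      by (intro integral_cong_AE) auto
    moreover have "(CLINT \<omega>|M. exp (Y \<omega> - variance Y / 2) *\<^sub>R iexp (X \<omega>)) = (CLINT \<omega>|M. iexp (X \<omega>))"
      using Y by (intro integral_cong_AE) (auto simp: True[unfolded v_def])
    ultimately show ?thesis using centered_gaussian_char[OF gX X0] by simp
  next
    case False
    \<comment> \<open>The regression coefficient of \<open>X\<close> on \<open>Y\<close>: exactly
      this choice makes \<open>Z\<close> uncorrelated with \<open>Y\<close>, hence independent of it
      by joint Gaussianity.\<close>
    define c where "c = k / v"
    define Z where "Z \<omega> = 1 * X \<omega> + (- c) * Y \<omega>" for \<omega>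
    have Z0: "expectation Z = 0" unfolding Z_def by (rule vl(1))
    have gZY: "gaussian_rv M (\<lambda>\<omega>. a * Z \<omega> + b * Y \<omega>)" for a b
      using g[of a "b - a * c"] by (simp add: Z_def algebra_simps)
    then have gZ: "gaussian_rv M Z" using gZY[of 1 0] by simp
    then have [measurable]: "Z \<in> borel_measurable M" by (simp add: gaussian_rv_def)
    have vZ: "variance Z = variance X - c\<^sup>2 * v"
      using False unfolding Z_def vl(2) v_def[symmetric] k_def[symmetric]
      by (simp add: c_def power2_eq_square)
    have "expectation (\<lambda>\<omega>. Z \<omega> * Y \<omega>) = expectation (\<lambda>\<omega>. X \<omega> * Y \<omega> - c * (Y \<omega>)\<^sup>2)"
      by (simp add: Z_def power2_eq_square algebra_simps)
    also have "\<dots> = k - c * v"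
      using int integrable_mult_of_squares[of X Y] by (simp add: k_def v_def Y0)
    finally have "expectation (\<lambda>\<omega>. Z \<omega> * Y \<omega>) = 0" using False by (simp add: c_def)
    then have ind: "indep_var borel Z borel Y"
      by (intro uncorrelated_gaussian_indep_var gZY Z0 Y0)
    have "indep_var borel (iexp \<circ> Z) borel ((\<lambda>y. exp (y - v / 2) *\<^sub>R iexp (c * y)) \<circ> Y)"
      by (rule indep_var_compose[OF ind]) measurable
    then have ind': "indep_var borel (\<lambda>\<omega>. iexp (Z \<omega>)) borel (\<lambda>\<omega>. exp (Y \<omega> - v / 2) *\<^sub>R iexp (c * Y \<omega>))"
      by (simp add: comp_def)
    have "integrable M (\<lambda>\<omega>. exp (Y \<omega>) * exp (- v / 2))"
      using centered_gaussian_mgf(1)[OF gY Y0] by simp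
    then have "integrable M (\<lambda>\<omega>. exp (Y \<omega> - v / 2))"
      by (simp only: mult_exp_exp) simp
    then have "integrable M (\<lambda>\<omega>. exp (Y \<omega> - v / 2) *\<^sub>R iexp (c * Y \<omega>))"
      by (rule Bochner_Integration.integrable_bound) auto
    moreover have "integrable M (\<lambda>\<omega>. iexp (Z \<omega>))" by (auto intro!: integrable_const_bound[of _ 1])
    ultimately have "(CLINT \<omega>|M. iexp (Z \<omega>) * (exp (Y \<omega> - v / 2) *\<^sub>R iexp (c * Y \<omega>))) =
        (CLINT \<omega>|M. iexp (Z \<omega>)) * (CLINT \<omega>|M. exp (Y \<omega> - v / 2) *\<^sub>R iexp (c * Y \<omega>))"
      by (intro indep_var_lebesgue_integral ind')
    also have "\<dots> = exp (- (variance X - c\<^sup>2 * v) / 2) * (iexp (c * v) * exp (- c\<^sup>2 * v / 2))"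
      using centered_gaussian_char[OF gZ Z0] centered_gaussian_tilted_char[OF gY Y0, of c]
      unfolding vZ v_def[symmetric] by simp
    \<comment> \<open>The part \<open>c\<^sup>2 * v\<close> missing from the variance of
      \<open>Z\<close> is returned by the tilted factor in \<open>Y\<close>, and the mean
      \<open>c * v\<close> of that factor is the covariance \<open>k\<close>.\<close>
    also have "\<dots> = iexp k * exp (- variance X / 2)"
    proof -
      have "exp (- (variance X - c\<^sup>2 * v) / 2) * exp (- c\<^sup>2 * v / 2) = exp (- variance X / 2)"
        unfolding mult_exp_exp by (simp add: field_simps)
      then have e: "complex_of_real (exp (- (variance X - c\<^sup>2 * v) / 2)) * complex_of_real (exp (- c\<^sup>2 * v / 2)) =
          complex_of_real (exp (- variance X / 2))"
        unfolding of_real_mult[symmetric] by (rule arg_cong)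
      have cv: "c * v = k" using False by (simp add: c_def)
      show ?thesis unfolding cv by (subst mult.left_commute) (simp only: e)
    qed
    also have "(\<lambda>\<omega>. iexp (Z \<omega>) * (exp (Y \<omega> - v / 2) *\<^sub>R iexp (c * Y \<omega>))) =
        (\<lambda>\<omega>. exp (Y \<omega> - v / 2) *\<^sub>R iexp (X \<omega>))"
      by (simp add: fun_eq_iff Z_def exp_add[symmetric] algebra_simps scaleR_conv_of_real)
    finally show ?thesis by (simp add: v_def k_def)
  qed
qed

end

section \<open>Processes with stationary Gaussian increments\<close>

text \<open>The linear span of the values of the process. Its elements are Gaussian and centered, so
  the closure rules below supply both properties for increments, averages and weighted sums without
  handling coefficients.\<close>

definition lin_comb :: "(real \<Rightarrow> 'a \<Rightarrow> real) \<Rightarrow> ('a \<Rightarrow> real) \<Rightarrow> bool" where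
  "lin_comb B X \<longleftrightarrow> (\<exists>I a. finite I \<and> X = (\<lambda>\<omega>. \<Sum>t\<in>I. a t * B t \<omega>))"

lemma lin_comb_zero: "lin_comb B (\<lambda>_. 0)"
  unfolding lin_comb_def by (intro exI[of _ "{}"]) auto

lemma lin_comb_self: "lin_comb B (B t)"
  unfolding lin_comb_def by (intro exI[of _ "{t}"] exI[of _ "\<lambda>_. 1"]) auto

lemma lin_comb_mult: "lin_comb B X \<Longrightarrow> lin_comb B (\<lambda>\<omega>. c * X \<omega>)"
  unfolding lin_comb_def
proof safe
  fix I :: "real set" and a assume "finite I"
  then show "\<exists>I' a'. finite I' \<and> (\<lambda>\<omega>. c * (\<Sum>t\<in>I. a t * B t \<omega>)) = (\<lambda>\<omega>. \<Sum>t\<in>I'. a' t * B t \<omega>)"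
    by (intro exI[of _ I] exI[of _ "\<lambda>t. c * a t"]) (simp add: sum_distrib_left mult.assoc)
qed

lemma lin_comb_add:
  assumes "lin_comb B X" "lin_comb B Y"
  shows "lin_comb B (\<lambda>\<omega>. X \<omega> + Y \<omega>)"
proof -
  obtain I a J b where I: "finite I" "X = (\<lambda>\<omega>. \<Sum>t\<in>I. a t * B t \<omega>)"
    and J: "finite J" "Y = (\<lambda>\<omega>. \<Sum>t\<in>J. b t * B t \<omega>)"
    using assms unfolding lin_comb_def by blast
  let ?c = "\<lambda>t. (if t \<in> I then a t else 0) + (if t \<in> J then b t else 0)"
  have "X \<omega> + Y \<omega> = (\<Sum>t\<in>I \<union> J. ?c t * B t \<omega>)" for \<omega>
  proof -
    have "(\<Sum>t\<in>I. a t * B t \<omega>) = (\<Sum>t\<in>I \<union> J. (if t \<in> I then a t else 0) * B t \<omega>)"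
      "(\<Sum>t\<in>J. b t * B t \<omega>) = (\<Sum>t\<in>I \<union> J. (if t \<in> J then b t else 0) * B t \<omega>)"
      using I J by (auto intro!: sum.mono_neutral_cong_left)
    then show ?thesis by (simp add: I J distrib_right sum.distrib)
  qed
  then show ?thesis
    unfolding lin_comb_def using I J by (intro exI[of _ "I \<union> J"] exI[of _ ?c]) auto
qed

lemma lin_comb_diff: "lin_comb B X \<Longrightarrow> lin_comb B Y \<Longrightarrow> lin_comb B (\<lambda>\<omega>. X \<omega> - Y \<omega>)"
  using lin_comb_add[of B X "\<lambda>\<omega>. (-1) * Y \<omega>"] lin_comb_mult[of B Y "-1"] by simp

lemma lin_comb_sum:
  assumes "finite F" "\<And>i. i \<in> F \<Longrightarrow> lin_comb B (X i)"
  shows "lin_comb B (\<lambda>\<omega>. \<Sum>i\<in>F. X i \<omega>)"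
  using assms by (induction F rule: finite_induct) (auto intro: lin_comb_add lin_comb_zero)

lemma iexp_add: "iexp (a + b) = iexp a * iexp b"
  by (simp add: exp_add distrib_left)

lemma dense_sequence_in_interval:
  fixes a b :: real
  assumes "a \<le> b"
  obtains d :: "nat \<Rightarrow> real" where "range d \<subseteq> {a..b}" "{a..b} \<subseteq> closure (range d)"
proof -
  obtain D where D: "countable D" "D \<subseteq> {a..b}" "{a..b} \<subseteq> closure D"
    using separable[of "{a..b}"] by metis
  have "D \<noteq> {}" using D assms by auto
  then have "range (from_nat_into D) = D" using D(1) by (rule range_from_nat_into)
  then show ?thesis using that[of "from_nat_into D"] D by simp
qed

text \<open>Every value on \<open>S\<close> is a limit of values on \<open>D\<close>. In
  \<open>ennreal\<close> both suprema are meaningful whether bounded or not.\<close>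

lemma SUP_dense_subset:
  fixes f :: "real \<Rightarrow> ennreal"
  assumes f: "continuous_on S f" and D: "D \<subseteq> S" "S \<subseteq> closure D"
  shows "(SUP t\<in>S. f t) = (SUP t\<in>D. f t)"
proof (rule antisym)
  show "(SUP t\<in>S. f t) \<le> (SUP t\<in>D. f t)"
  proof (rule SUP_least)
    fix t assume t: "t \<in> S"
    then obtain x where x: "\<And>n. x n \<in> D" "x \<longlonglongrightarrow> t" using D closure_sequential[of t D] by blast
    have "(\<lambda>n. f (x n)) \<longlonglongrightarrow> f t"
      using f x D t by (intro continuous_on_tendsto_compose[OF f] always_eventually) auto
    then show "f t \<le> (SUP t\<in>D. f t)"
      by (rule LIMSEQ_le_const2) (use x in \<open>auto intro: SUP_upper\<close>)
  qed
  show "(SUP t\<in>D. f t) \<le> (SUP t\<in>S. f t)" using D by (intro SUP_subset_mono) auto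
qed

locale gaussian_increments = prob_space M for M :: "'a measure" +
  fixes B :: "real \<Rightarrow> 'a \<Rightarrow> real"
  assumes gaussian: "gaussian_process M B"
    and centered: "centered_process M B"
    and stationary: "stationary_increments M B"
    and continuous: "continuous_paths M B"
    and start: "AE \<omega> in M. B 0 \<omega> = 0"
begin

abbreviation "v \<equiv> variance_function M B"
abbreviation "W \<equiv> drifted_process M B"

lemma gaussian_lin_comb: "lin_comb B X \<Longrightarrow> gaussian_rv M X"
  using gaussian unfolding gaussian_process_def lin_comb_def by blast

lemma B_measurable[measurable]: "B t \<in> borel_measurable M"
  using gaussian_lin_comb[OF lin_comb_self] by (simp add: gaussian_rv_def)

lemma expectation_B: "expectation (B t) = 0"
  using centered by (simp add: centered_process_def)

lemma B_moments: "integrable M (B t)" "integrable M (\<lambda>\<omega>. (B t \<omega>)\<^sup>2)"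
  using centered_gaussian_moments[OF gaussian_lin_comb[OF lin_comb_self] expectation_B] by auto

lemma expectation_lin_comb: "lin_comb B X \<Longrightarrow> expectation X = 0"
  unfolding lin_comb_def using B_moments expectation_B by auto

lemma lin_comb_moments:
  assumes "lin_comb B X"
  shows "integrable M X" "integrable M (\<lambda>\<omega>. (X \<omega>)\<^sup>2)"
  using centered_gaussian_moments[OF gaussian_lin_comb expectation_lin_comb, OF assms assms] by auto

lemma variance_lin_comb: "lin_comb B X \<Longrightarrow> variance X = expectation (\<lambda>\<omega>. (X \<omega>)\<^sup>2)"
  by (simp add: expectation_lin_comb)

lemma v_eq: "v t = expectation (\<lambda>\<omega>. (B t \<omega>)\<^sup>2)"
  by (simp add: variance_function_def expectation_B)

text \<open>The only place where stationarity and \<open>B 0 = 0\<close> enter. A square of a linear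
  functional of the path is measurable for the product sigma-algebra, so its mean is read off from
  the law of the increments; all variances and covariances of increments below follow from
  this.\<close>

lemma increments_second_moment:
  assumes "finite F"
  shows "expectation (\<lambda>\<omega>. (\<Sum>t\<in>F. u t * (B (t + h) \<omega> - B h \<omega>))\<^sup>2) =
    expectation (\<lambda>\<omega>. (\<Sum>t\<in>F. u t * B t \<omega>)\<^sup>2)"
proof -
  let ?P = "PiM UNIV (\<lambda>_. borel) :: (real \<Rightarrow> real) measure"
  let ?g = "\<lambda>x :: real \<Rightarrow> real. (\<Sum>t\<in>F. u t * x t)\<^sup>2"
  have [measurable]: "(\<lambda>\<omega> t. B (t + h) \<omega> - B h \<omega>) \<in> M \<rightarrow>\<^sub>M ?P" for h
    by (rule measurable_PiM_single') auto
  have m: "?g \<in> borel_measurable ?P"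
    by measurable
  have "expectation (\<lambda>\<omega>. ?g (\<lambda>t. B (t + h) \<omega> - B h \<omega>)) =
      (\<integral>x. ?g x \<partial>distr M ?P (\<lambda>\<omega> t. B (t + h) \<omega> - B h \<omega>))"
    by (rule integral_distr[symmetric]) (use m in measurable)
  also have "\<dots> = (\<integral>x. ?g x \<partial>distr M ?P (\<lambda>\<omega> t. B t \<omega> - B 0 \<omega>))"
    using stationary by (simp add: stationary_increments_def)
  also have "\<dots> = expectation (\<lambda>\<omega>. ?g (\<lambda>t. B t \<omega> - B 0 \<omega>))"
    using \<open>(\<lambda>\<omega> t. B (t + 0) \<omega> - B 0 \<omega>) \<in> M \<rightarrow>\<^sub>M ?P\<close>
    by (intro integral_distr) (use m in auto)
  also have "\<dots> = expectation (\<lambda>\<omega>. ?g (\<lambda>t. B t \<omega>))"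
    by (intro integral_cong_AE) (use start in auto)
  finally show ?thesis .
qed

lemma increment_variance: "expectation (\<lambda>\<omega>. (B (t + h) \<omega> - B h \<omega>)\<^sup>2) = v t"
  using increments_second_moment[of "{t}" "\<lambda>_. 1" h] by (simp add: v_eq)

text \<open>Expand the square of \<open>B (t + h)\<close> as increment plus \<open>B h\<close>. By
  the Gaussian tilt formula, this covariance is the mean that the density \<open>exp (W h)\<close>
  gives to the increment.\<close>

lemma increment_covariance:
  "expectation (\<lambda>\<omega>. (B (t + h) \<omega> - B h \<omega>) * B h \<omega>) = (v (t + h) - v t - v h) / 2"
proof -
  let ?D = "\<lambda>\<omega>. B (t + h) \<omega> - B h \<omega>"
  have D: "lin_comb B ?D" by (intro lin_comb_diff lin_comb_self)
  have i: "integrable M (\<lambda>\<omega>. ?D \<omega> * B h \<omega>)"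
    by (intro integrable_mult_of_squares B_moments lin_comb_moments D) measurable
  have "v (t + h) = expectation (\<lambda>\<omega>. (?D \<omega>)\<^sup>2 + 2 * (?D \<omega> * B h \<omega>) + (B h \<omega>)\<^sup>2)"
    unfolding v_eq by (intro Bochner_Integration.integral_cong refl) (simp add: power2_eq_square algebra_simps)
  also have "\<dots> = v t + 2 * expectation (\<lambda>\<omega>. ?D \<omega> * B h \<omega>) + v h"
    using i lin_comb_moments(2)[OF D] B_moments(2)[of h] by (simp add: increment_variance v_eq)
  finally show ?thesis by simp
qed

text \<open>Continuity of second moments would require control of the squares near each time. The
  characteristic function \<open>exp (- v t / 2)\<close> has a bounded integrand instead, so
  dominated convergence along continuous paths applies, and a logarithm recovers \<open>v\<close>.
  Continuity of the drift makes the paths of \<open>W\<close> continuous.\<close>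

lemma continuous_on_v: "continuous_on UNIV v"
proof -
  have c: "(CLINT \<omega>|M. iexp (B t \<omega>)) = exp (- v t / 2)" for t
    using centered_gaussian_char[OF gaussian_lin_comb[OF lin_comb_self] expectation_B]
    by (simp add: variance_function_def)
  have "continuous_on UNIV (\<lambda>t. CLINT \<omega>|M. iexp (B t \<omega>))"
    unfolding continuous_on_sequentially comp_def
  proof safe
    fix x :: "nat \<Rightarrow> real" and a assume x: "x \<longlonglongrightarrow> a"
    show "(\<lambda>n. CLINT \<omega>|M. iexp (B (x n) \<omega>)) \<longlonglongrightarrow> (CLINT \<omega>|M. iexp (B a \<omega>))"
    proof (rule integral_dominated_convergence[where w = "\<lambda>_. 1"])
      show "AE \<omega> in M. (\<lambda>n. iexp (B (x n) \<omega>)) \<longlonglongrightarrow> iexp (B a \<omega>)"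
      proof (rule AE_I2)
        fix \<omega> assume "\<omega> \<in> space M"
        then have "continuous_on UNIV (\<lambda>t. B t \<omega>)" using continuous by (simp add: continuous_paths_def)
        then have "(\<lambda>n. B (x n) \<omega>) \<longlonglongrightarrow> B a \<omega>"
          using x by (auto intro: continuous_on_tendsto_compose)
        then show "(\<lambda>n. iexp (B (x n) \<omega>)) \<longlonglongrightarrow> iexp (B a \<omega>)" by (intro tendsto_intros)
      qed
    qed auto
  qed
  from continuous_on_Re[OF this] have "continuous_on UNIV (\<lambda>t. exp (- v t / 2))"
    unfolding c by (simp only: Re_complex_of_real)
  then have "continuous_on UNIV (\<lambda>t. - 2 * ln (exp (- v t / 2)))"
    by (intro continuous_on_mult continuous_on_const continuous_on_ln) auto
  then show ?thesis by simp
qed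

lemma W_measurable[measurable]: "W t \<in> borel_measurable M"
  unfolding drifted_process_def by measurable

lemma W_continuous:
  assumes "\<omega> \<in> space M"
  shows "continuous_on S (\<lambda>t. W t \<omega>)"
proof -
  have "continuous_on UNIV (\<lambda>t. B t \<omega>)" using assms continuous by (simp add: continuous_paths_def)
  moreover have "continuous_on UNIV (\<lambda>t. v t * (1 / 2))"
    by (rule continuous_on_mult_right[OF continuous_on_v])
  ultimately have "continuous_on UNIV (\<lambda>t. B t \<omega> - v t * (1 / 2))" by (rule continuous_on_diff)
  then have "continuous_on UNIV (\<lambda>t. W t \<omega>)" by (simp add: drifted_process_def)
  then show ?thesis by (rule continuous_on_subset) simp
qed

section \<open>Change of measure by \<open>exp (W h)\<close> and shift invariance of the expected
  supremum\<close>

lemma exp_W_integrable: "integrable M (\<lambda>\<omega>. exp (W t \<omega>))"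
  and expectation_exp_W: "expectation (\<lambda>\<omega>. exp (W t \<omega>)) = 1"
  using centered_gaussian_mgf[OF gaussian_lin_comb[OF lin_comb_self] expectation_B, of t]
  by (simp_all add: drifted_process_def exp_diff variance_function_def)

text \<open>The combination of increments of \<open>W\<close> is \<open>X - k\<close>, where
  \<open>k\<close> collects their drift. The tilt adds the covariance \<open>k - k0\<close> to the
  mean, leaving \<open>- k0\<close>, which is precisely the drift of the combination of the values
  \<open>W t\<close>. The variances of \<open>X\<close> and \<open>X0\<close> agree by
  stationarity.\<close>

lemma tilted_increments_char:
  assumes F: "finite F"
  shows "(CLINT \<omega>|M. exp (W h \<omega>) *\<^sub>R iexp (\<Sum>t\<in>F. u t * (W (t + h) \<omega> - W h \<omega>))) =
    (CLINT \<omega>|M. iexp (\<Sum>t\<in>F. u t * W t \<omega>))"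
proof -
  define X where "X \<omega> = (\<Sum>t\<in>F. u t * (B (t + h) \<omega> - B h \<omega>))" for \<omega>
  define X0 where "X0 \<omega> = (\<Sum>t\<in>F. u t * B t \<omega>)" for \<omega>
  define k where "k = (\<Sum>t\<in>F. u t * ((v (t + h) - v h) / 2))"
  define k0 where "k0 = (\<Sum>t\<in>F. u t * (v t / 2))"
  have lX: "lin_comb B X" unfolding X_def by (intro lin_comb_sum F lin_comb_mult lin_comb_diff lin_comb_self)
  have lX0: "lin_comb B X0" unfolding X0_def by (intro lin_comb_sum F lin_comb_mult lin_comb_self)
  have vX: "variance X = variance X0"
    unfolding variance_lin_comb[OF lX] variance_lin_comb[OF lX0]
    unfolding X_def X0_def by (rule increments_second_moment[OF F])
  have "expectation (\<lambda>\<omega>. X \<omega> * B h \<omega>) = expectation (\<lambda>\<omega>. \<Sum>t\<in>F. u t * ((B (t + h) \<omega> - B h \<omega>) * B h \<omega>))"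
    by (simp add: X_def sum_distrib_right mult.assoc)
  also have "\<dots> = (\<Sum>t\<in>F. u t * ((v (t + h) - v t - v h) / 2))"
  proof -
    have "integrable M (\<lambda>\<omega>. (B (t + h) \<omega> - B h \<omega>) * B h \<omega>)" for t
      by (intro integrable_mult_of_squares B_moments lin_comb_moments lin_comb_diff lin_comb_self) measurable
    then show ?thesis by (subst Bochner_Integration.integral_sum) (simp_all add: increment_covariance)
  qed
  also have "\<dots> = k - k0"
    unfolding k_def k0_def sum_subtractf[symmetric] by (intro sum.cong refl) (simp add: field_simps)
  finally have cov: "expectation (\<lambda>\<omega>. X \<omega> * B h \<omega>) = k - k0" .
  have "(CLINT \<omega>|M. exp (W h \<omega>) *\<^sub>R iexp (\<Sum>t\<in>F. u t * (W (t + h) \<omega> - W h \<omega>))) =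
      (CLINT \<omega>|M. iexp (- k) * (exp (B h \<omega> - v h / 2) *\<^sub>R iexp (X \<omega>)))"
  proof (intro Bochner_Integration.integral_cong refl)
    fix \<omega>
    have "(\<Sum>t\<in>F. u t * (W (t + h) \<omega> - W h \<omega>)) = - k + X \<omega>"
    proof -
      have "(\<Sum>t\<in>F. u t * (W (t + h) \<omega> - W h \<omega>)) =
          (\<Sum>t\<in>F. - (u t * ((v (t + h) - v h) / 2)) + u t * (B (t + h) \<omega> - B h \<omega>))"
        by (intro sum.cong refl) (simp add: drifted_process_def field_simps)
      then show ?thesis by (simp only: sum.distrib sum_negf X_def k_def)
    qed
    then show "exp (W h \<omega>) *\<^sub>R iexp (\<Sum>t\<in>F. u t * (W (t + h) \<omega> - W h \<omega>)) =
      iexp (- k) * (exp (B h \<omega> - v h / 2) *\<^sub>R iexp (X \<omega>))"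
      using drifted_process_def[of M B h \<omega>] by (simp only: iexp_add mult_scaleR_right)
  qed
  also have "\<dots> = iexp (- k) * (iexp (k - k0) * exp (- variance X / 2))"
  proof -
    have "gaussian_rv M (\<lambda>\<omega>. a * X \<omega> + b * B h \<omega>)" for a b
      by (intro gaussian_lin_comb lin_comb_add lin_comb_mult lin_comb_self lX)
    from gaussian_exponential_tilt_char[OF this expectation_lin_comb[OF lX] expectation_B]
    show ?thesis
      unfolding integral_mult_right_zero cov variance_function_def by (simp only:)
  qed
  also have "\<dots> = iexp (- k0) * exp (- variance X0 / 2)"
    unfolding vX mult.assoc[symmetric] iexp_add[symmetric] by simp
  also have "\<dots> = iexp (- k0) * (CLINT \<omega>|M. iexp (X0 \<omega>))"
    using centered_gaussian_char[OF gaussian_lin_comb expectation_lin_comb, OF lX0 lX0] by simp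
  also have "\<dots> = (CLINT \<omega>|M. iexp (- k0) * iexp (X0 \<omega>))" by simp
  also have "\<dots> = (CLINT \<omega>|M. iexp (\<Sum>t\<in>F. u t * W t \<omega>))"
  proof (intro Bochner_Integration.integral_cong refl)
    fix \<omega>
    have "(\<Sum>t\<in>F. u t * W t \<omega>) = - k0 + X0 \<omega>"
    proof -
      have "(\<Sum>t\<in>F. u t * W t \<omega>) = (\<Sum>t\<in>F. - (u t * (v t / 2)) + u t * B t \<omega>)"
        by (intro sum.cong refl) (simp add: drifted_process_def field_simps)
      then show ?thesis by (simp only: sum.distrib sum_negf X0_def k0_def)
    qed
    then show "iexp (- k0) * iexp (X0 \<omega>) = iexp (\<Sum>t\<in>F. u t * W t \<omega>)"
      by (simp only: iexp_add)
  qed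
  finally show ?thesis .
qed

text \<open>Write \<open>exp (W (t + h))\<close> as \<open>exp (W h)\<close> times the exponential
  of the increment. The first factor does not depend on \<open>t\<close>, so it leaves the supremum
  and becomes the density of \<open>?N\<close>, under which the increments on \<open>F\<close> have
  the joint law of \<open>W\<close>.\<close>

lemma nn_integral_finite_sup_shift:
  assumes F: "finite F"
  shows "(\<integral>\<^sup>+\<omega>. (SUP t\<in>F. ennreal (exp (W (t + h) \<omega>))) \<partial>M) = (\<integral>\<^sup>+\<omega>. (SUP t\<in>F. ennreal (exp (W t \<omega>))) \<partial>M)"
proof -
  let ?N = "density M (\<lambda>\<omega>. ennreal (exp (W h \<omega>)))"
  let ?P = "PiM F (\<lambda>_. borel) :: (real \<Rightarrow> real) measure"
  let ?G = "\<lambda>x :: real \<Rightarrow> real. SUP t\<in>F. ennreal (exp (x t))"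
  have cF: "countable F" using F by (rule countable_finite)
  have [measurable]: "?G \<in> borel_measurable ?P"
    using cF by measurable
  have D: "distr ?N ?P (\<lambda>\<omega>. \<lambda>t\<in>F. W (t + h) \<omega> - W h \<omega>) = distr M ?P (\<lambda>\<omega>. \<lambda>t\<in>F. W t \<omega>)"
  proof (rule distr_PiM_eqI_char[OF F _ finite_measure_axioms])
    show "finite_measure ?N"
      by (rule finite_measureI) (simp add: emeasure_density nn_integral_eq_integral exp_W_integrable)
    fix u
    have "(CLINT \<omega>|?N. iexp (\<Sum>t\<in>F. u t * (W (t + h) \<omega> - W h \<omega>))) =
        (CLINT \<omega>|M. exp (W h \<omega>) *\<^sub>R iexp (\<Sum>t\<in>F. u t * (W (t + h) \<omega> - W h \<omega>)))"
      by (rule integral_density) auto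
    also have "\<dots> = (CLINT \<omega>|M. iexp (\<Sum>t\<in>F. u t * W t \<omega>))"
      by (rule tilted_increments_char[OF F])
    finally show "(CLINT \<omega>|?N. iexp (\<Sum>t\<in>F. u t * (W (t + h) \<omega> - W h \<omega>))) =
        (CLINT \<omega>|M. iexp (\<Sum>t\<in>F. u t * W t \<omega>))" .
  qed auto
  have "(\<integral>\<^sup>+\<omega>. (SUP t\<in>F. ennreal (exp (W (t + h) \<omega>))) \<partial>M) =
      (\<integral>\<^sup>+\<omega>. ennreal (exp (W h \<omega>)) * ?G (\<lambda>t\<in>F. W (t + h) \<omega> - W h \<omega>) \<partial>M)"
  proof (rule nn_integral_cong)
    fix \<omega>
    have "(SUP t\<in>F. ennreal (exp (W (t + h) \<omega>))) =
        (SUP t\<in>F. ennreal (exp (W h \<omega>)) * ennreal (exp (W (t + h) \<omega> - W h \<omega>)))"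
      by (simp only: ennreal_mult[symmetric] exp_ge_zero mult_exp_exp) simp
    also have "\<dots> = ennreal (exp (W h \<omega>)) * (SUP t\<in>F. ennreal (exp (W (t + h) \<omega> - W h \<omega>)))"
      by (rule SUP_mult_left_ennreal[symmetric])
    finally show "(SUP t\<in>F. ennreal (exp (W (t + h) \<omega>))) =
        ennreal (exp (W h \<omega>)) * ?G (\<lambda>t\<in>F. W (t + h) \<omega> - W h \<omega>)"
      by simp
  qed
  also have "\<dots> = (\<integral>\<^sup>+\<omega>. ?G (\<lambda>t\<in>F. W (t + h) \<omega> - W h \<omega>) \<partial>?N)"
    by (rule nn_integral_density[symmetric]) measurable
  also have "\<dots> = (\<integral>\<^sup>+x. ?G x \<partial>distr ?N ?P (\<lambda>\<omega>. \<lambda>t\<in>F. W (t + h) \<omega> - W h \<omega>))"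
    by (rule nn_integral_distr[symmetric]) measurable
  also have "\<dots> = (\<integral>\<^sup>+\<omega>. ?G (\<lambda>t\<in>F. W t \<omega>) \<partial>M)"
    unfolding D by (rule nn_integral_distr) measurable
  also have "\<dots> = (\<integral>\<^sup>+\<omega>. (SUP t\<in>F. ennreal (exp (W t \<omega>))) \<partial>M)"
    by (intro nn_integral_cong) simp
  finally show ?thesis .
qed

text \<open>The supremum over the interval is the increasing limit of suprema over initial segments
  of a dense sequence. The same sequence serves for the shifts \<open>h\<close> and 0, so the two
  limits are compared term by term.\<close>

lemma nn_integral_sup_shift:
  assumes "a \<le> b"
  shows "(\<integral>\<^sup>+\<omega>. (SUP t\<in>{a + h..b + h}. ennreal (exp (W t \<omega>))) \<partial>M) =
    (\<integral>\<^sup>+\<omega>. (SUP t\<in>{a..b}. ennreal (exp (W t \<omega>))) \<partial>M)"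
proof -
  obtain d :: "nat \<Rightarrow> real" where d: "range d \<subseteq> {a..b}" "{a..b} \<subseteq> closure (range d)"
    using dense_sequence_in_interval[OF assms] by metis
  have *: "(\<integral>\<^sup>+\<omega>. (SUP t\<in>{a..b}. ennreal (exp (W (t + h) \<omega>))) \<partial>M) =
      (SUP n. \<integral>\<^sup>+\<omega>. (SUP t\<in>d ` {..n}. ennreal (exp (W (t + h) \<omega>))) \<partial>M)" for h
  proof -
    have "(\<integral>\<^sup>+\<omega>. (SUP t\<in>{a..b}. ennreal (exp (W (t + h) \<omega>))) \<partial>M) =
      (\<integral>\<^sup>+\<omega>. (SUP n. SUP t\<in>d ` {..n}. ennreal (exp (W (t + h) \<omega>))) \<partial>M)"
    proof (rule nn_integral_cong)
      fix \<omega> assume "\<omega> \<in> space M"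
      then have "continuous_on {a..b} (\<lambda>t. ennreal (exp (W (t + h) \<omega>)))"
        by (intro continuous_on_ennreal continuous_on_exp continuous_on_compose2[OF W_continuous[of \<omega> UNIV]] continuous_intros) auto
      then have "(SUP t\<in>{a..b}. ennreal (exp (W (t + h) \<omega>))) = (SUP t\<in>range d. ennreal (exp (W (t + h) \<omega>)))"
        using d by (rule SUP_dense_subset)
      also have "range d = (\<Union>n. d ` {..n})" by auto
      finally show "(SUP t\<in>{a..b}. ennreal (exp (W (t + h) \<omega>))) =
          (SUP n. SUP t\<in>d ` {..n}. ennreal (exp (W (t + h) \<omega>)))"
        by (simp add: SUP_UNION image_image)
    qed
    also have "\<dots> = (SUP n. \<integral>\<^sup>+\<omega>. (SUP t\<in>d ` {..n}. ennreal (exp (W (t + h) \<omega>))) \<partial>M)"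
    proof (rule nn_integral_monotone_convergence_SUP)
      show "incseq (\<lambda>n \<omega>. SUP t\<in>d ` {..n}. ennreal (exp (W (t + h) \<omega>)))"
        by (intro monoI le_funI SUP_subset_mono) auto
    qed measurable
    finally show ?thesis .
  qed
  have "{a + h..b + h} = (\<lambda>t. t + h) ` {a..b}" by simp
  then have "(\<integral>\<^sup>+\<omega>. (SUP t\<in>{a + h..b + h}. ennreal (exp (W t \<omega>))) \<partial>M) =
      (\<integral>\<^sup>+\<omega>. (SUP t\<in>{a..b}. ennreal (exp (W (t + h) \<omega>))) \<partial>M)"
    by (simp only: image_image)
  also have "\<dots> = (\<integral>\<^sup>+\<omega>. (SUP t\<in>{a..b}. ennreal (exp (W t \<omega>))) \<partial>M)"
  proof -
    have "(SUP n. \<integral>\<^sup>+\<omega>. (SUP t\<in>d ` {..n}. ennreal (exp (W (t + h) \<omega>))) \<partial>M) =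
        (SUP n. \<integral>\<^sup>+\<omega>. (SUP t\<in>d ` {..n}. ennreal (exp (W t \<omega>))) \<partial>M)"
      by (intro SUP_cong refl nn_integral_finite_sup_shift) auto
    then show ?thesis using *[of h] *[of 0] by (simp only: add_0_right)
  qed
  finally show ?thesis .
qed

end

section \<open>Growth of the expected supremum\<close>

text \<open>Fekete's lemma for a real parameter; the limit is the infimum of the quotients.
  Subadditivity controls multiples of one \<open>T0\<close>, and monotonicity reaches a general
  \<open>T\<close> by rounding it up to such a multiple.\<close>

lemma subadditive_quotient_tendsto:
  fixes f :: "real \<Rightarrow> real"
  assumes sub: "\<And>S T. 0 < S \<Longrightarrow> 0 < T \<Longrightarrow> f (S + T) \<le> f S + f T"
    and mono: "\<And>S T. 0 < S \<Longrightarrow> S \<le> T \<Longrightarrow> f S \<le> f T"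
    and nonneg: "\<And>T. 0 < T \<Longrightarrow> 0 \<le> f T"
  obtains L where "((\<lambda>T. f T / T) \<longlongrightarrow> L) at_top"
proof
  let ?A = "(\<lambda>T. f T / T) ` {0<..}"
  have bdd: "bdd_below ?A" by (rule bdd_belowI[of _ 0]) (auto simp: nonneg)
  \<comment> \<open>Counting from \<open>Suc n\<close> avoids the value of \<open>f\<close> at 0,
    about which nothing is assumed.\<close>
  have mult: "f (real (Suc n) * T) \<le> real (Suc n) * f T" if "T > 0" for n T
  proof (induction n)
    case (Suc n)
    have "f (real (Suc (Suc n)) * T) = f (real (Suc n) * T + T)" by (simp add: algebra_simps)
    also have "\<dots> \<le> f (real (Suc n) * T) + f T" using that by (intro sub) auto
    finally show ?case using Suc by (simp add: algebra_simps)
  qed simp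
  show "((\<lambda>T. f T / T) \<longlongrightarrow> Inf ?A) at_top"
  proof (rule order_tendstoI)
    fix a assume "a < Inf ?A"
    then show "eventually (\<lambda>T. a < f T / T) at_top"
      by (intro eventually_mono[OF eventually_gt_at_top[of 0]]) (use bdd in \<open>auto intro: less_le_trans cInf_lower\<close>)
  next
    fix a assume "Inf ?A < a"
    then obtain T0 where T0: "T0 > 0" "f T0 / T0 < a"
      by (subst (asm) cInf_less_iff) (use bdd in auto)
    have "((\<lambda>T. f T0 / T0 + f T0 * inverse T) \<longlongrightarrow> f T0 / T0 + f T0 * 0) at_top"
      by (intro tendsto_intros tendsto_inverse_0_at_top filterlim_ident)
    then have "eventually (\<lambda>T. f T0 / T0 + f T0 * inverse T < a) at_top"
      using T0 by (intro order_tendstoD) auto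
    then show "eventually (\<lambda>T. f T / T < a) at_top"
      using eventually_gt_at_top[of 0]
    proof eventually_elim
      case (elim T)
      \<comment> \<open>Rounding up to \<open>Suc n\<close> blocks of length \<open>T0\<close> costs
        at most one additional \<open>f T0\<close>, which vanishes after division by
        \<open>T\<close>.\<close>
      define n where "n = nat \<lfloor>T / T0\<rfloor>"
      have "0 \<le> T / T0" using elim T0 by simp
      then have n: "real n \<le> T / T0" "T / T0 \<le> real (Suc n)"
        unfolding n_def by (simp_all add: of_nat_nat) linarith
      have "f T \<le> f (real (Suc n) * T0)"
        using n elim T0 by (intro mono) (auto simp: field_simps)
      also have "\<dots> \<le> real (Suc n) * f T0" by (rule mult[OF T0(1)])
      also have "\<dots> \<le> (T / T0 + 1) * f T0"
        using n T0 nonneg by (intro mult_right_mono) auto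
      finally have "f T / T \<le> (T / T0 + 1) * f T0 / T" using elim by (simp add: divide_right_mono)
      also have "\<dots> = f T0 / T0 + f T0 * inverse T" using elim T0 by (simp add: field_simps)
      finally show ?case using elim by simp
    qed
  qed
qed

text \<open>Induction on \<open>n\<close>. If some earlier value is at least \<open>x n\<close>, the
  geometric mean of the two is at least \<open>x n\<close>, so the new pairs absorb the new term.
  Otherwise each earlier \<open>x j\<close> is at most its geometric mean with \<open>x n\<close>,
  so the new pairs absorb all earlier terms and only \<open>x n\<close> remains.\<close>

lemma sum_minus_sqrt_le_upper_bound:
  fixes x :: "nat \<Rightarrow> real"
  assumes "\<And>k. x k \<ge> 0" "\<And>k. k < n \<Longrightarrow> x k \<le> s" "0 \<le> s"
  shows "(\<Sum>k<n. x k) - (\<Sum>k<n. \<Sum>j<k. sqrt (x j * x k)) \<le> s"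
  using assms(2)
proof (induction n)
  case 0
  then show ?case using assms(3) by simp
next
  case (Suc n)
  show ?case
  proof (cases "\<exists>m<n. x n \<le> x m")
    case True
    then obtain m where m: "m < n" "x n \<le> x m" by blast
    have "x n = sqrt (x n * x n)" using assms(1) by simp
    also have "\<dots> \<le> sqrt (x m * x n)" using m assms(1) by (intro real_sqrt_le_mono mult_right_mono)
    also have "\<dots> \<le> (\<Sum>j<n. sqrt (x j * x n))" using m assms(1) by (intro member_le_sum) auto
    finally show ?thesis using Suc.IH Suc.prems by simp
  next
    case False
    have "(\<Sum>k<n. x k) \<le> (\<Sum>j<n. sqrt (x j * x n))"
    proof (rule sum_mono)
      fix j assume "j \<in> {..<n}"
      then have "x j \<le> x n" using False by force
      have "x j = sqrt (x j * x j)" using assms(1) by simp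
      also have "\<dots> \<le> sqrt (x j * x n)"
        using \<open>x j \<le> x n\<close> assms(1) by (intro real_sqrt_le_mono mult_left_mono)
      finally show "x j \<le> sqrt (x j * x n)" .
    qed
    moreover have "0 \<le> (\<Sum>k<n. \<Sum>j<k. sqrt (x j * x k))" using assms(1) by (intro sum_nonneg) simp
    moreover have "x n \<le> s" using Suc.prems by simp
    ultimately show ?thesis by simp
  qed
qed

text \<open>A real \<open>c\<close> strictly between 8 and the lower limit gives the exponent
  \<open>p = c / 8 > 1\<close>. The spacing factors out of the resulting bound as
  \<open>a powr (- p)\<close> times a convergent series, so a large \<open>a\<close> makes the sum
  small uniformly in \<open>k\<close>.\<close>

lemma log_growth_exp_sum_le:
  fixes g :: "real \<Rightarrow> real"
  assumes "Liminf at_top (\<lambda>t. ereal (g t / ln t)) > 8"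
  obtains a where "a > 0" "\<And>k. (\<Sum>m<k. exp (- g (a * real (Suc m)) / 8)) \<le> 1 / 2"
proof -
  obtain c where c: "8 < ereal c" "ereal c < Liminf at_top (\<lambda>t. ereal (g t / ln t))"
    using ereal_dense2[OF assms] by blast
  have "eventually (\<lambda>t. c < g t / ln t) at_top"
    using less_LiminfD[OF c(2)] by simp
  then obtain t0 where t0: "\<And>t. t \<ge> t0 \<Longrightarrow> c < g t / ln t" by (auto simp: eventually_at_top_linorder)
  define p where "p = c / 8"
  have p: "p > 1" using c(1) by (simp add: p_def)
  have sm: "summable (\<lambda>m. real (Suc m) powr (- p))"
    using p by (subst summable_Suc_iff) (simp add: summable_real_powr_iff)
  define \<zeta> where "\<zeta> = (\<Sum>m. real (Suc m) powr (- p))"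
  have "((\<lambda>a. a powr (- p) * \<zeta>) \<longlongrightarrow> 0 * \<zeta>) at_top"
    using p by (intro tendsto_intros tendsto_neg_powr filterlim_ident) auto
  then have "eventually (\<lambda>a. a powr (- p) * \<zeta> < 1 / 2) at_top"
    by (rule order_tendstoD) simp
  \<comment> \<open>All lattice distances are at least \<open>a\<close>. Hence \<open>t0\<close>
    puts them in the range of the growth bound, and 2 makes their logarithm positive, so that the
    quotient bound can be multiplied out.\<close>
  then have "eventually (\<lambda>a. a powr (- p) * \<zeta> < 1 / 2 \<and> a \<ge> max t0 2) at_top"
    using eventually_ge_at_top[of "max t0 2"] by eventually_elim simp
  then obtain a where a: "a powr (- p) * \<zeta> < 1 / 2" "a \<ge> max t0 2"
    using eventually_happens by force
  show thesis
  proof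
    show "a > 0" using a by simp
    fix k
    have "(\<Sum>m<k. exp (- g (a * real (Suc m)) / 8)) \<le> (\<Sum>m<k. a powr (- p) * real (Suc m) powr (- p))"
    proof (rule sum_mono)
      fix m
      define t where "t = a * real (Suc m)"
      have "a * 1 \<le> t" unfolding t_def using a by (intro mult_left_mono) auto
      then have t: "t \<ge> t0" "t \<ge> 2" using a by auto
      then have "c * ln t < g t" using t0[of t] by (simp add: field_simps)
      then have "exp (- g t / 8) \<le> exp (- p * ln t)" by (simp add: p_def)
      also have "\<dots> = t powr (- p)" using t by (simp add: powr_def)
      also have "\<dots> = a powr (- p) * real (Suc m) powr (- p)"
        unfolding t_def by (rule powr_mult)
      finally show "exp (- g (a * real (Suc m)) / 8) \<le> a powr (- p) * real (Suc m) powr (- p)"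
        unfolding t_def .
    qed
    also have "\<dots> = a powr (- p) * (\<Sum>m<k. real (Suc m) powr (- p))" by (rule sum_distrib_left[symmetric])
    also have "\<dots> \<le> a powr (- p) * \<zeta>"
      unfolding \<zeta>_def using sm by (intro mult_left_mono sum_le_suminf) auto
    finally show "(\<Sum>m<k. exp (- g (a * real (Suc m)) / 8)) \<le> 1 / 2" using a(1) by simp
  qed
qed

section \<open>Subadditivity, lattice lower bound and positivity of the constant\<close>

context gaussian_increments
begin

text \<open>The parallelogram identity gives the average of \<open>B s\<close> and
  \<open>B t\<close> the variance \<open>v s / 2 + v t / 2 - v (t - s) / 4\<close>. Half of it, less
  the averaged drift \<open>(v s + v t) / 4\<close>, leaves \<open>- v (t - s) / 8\<close>: this is
  the origin of the 8 in the growth condition.\<close>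

lemma expectation_exp_average:
  "integrable M (\<lambda>\<omega>. exp ((W s \<omega> + W t \<omega>) / 2))"
  "expectation (\<lambda>\<omega>. exp ((W s \<omega> + W t \<omega>) / 2)) = exp (- v (t - s) / 8)"
proof -
  define X where "X \<omega> = (1 / 2) * (B s \<omega> + B t \<omega>)" for \<omega>
  have lX: "lin_comb B X" unfolding X_def by (intro lin_comb_mult lin_comb_add lin_comb_self)
  have lD: "lin_comb B (\<lambda>\<omega>. B t \<omega> - B s \<omega>)" by (intro lin_comb_diff lin_comb_self)
  have "variance X = expectation (\<lambda>\<omega>. (B s \<omega>)\<^sup>2 / 2 + (B t \<omega>)\<^sup>2 / 2 - (B t \<omega> - B s \<omega>)\<^sup>2 / 4)"
    unfolding variance_lin_comb[OF lX] unfolding X_def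
    by (intro Bochner_Integration.integral_cong refl) (simp add: power2_eq_square field_simps)
  also have "\<dots> = v s / 2 + v t / 2 - v (t - s) / 4"
    using increment_variance[of "t - s" s] B_moments lin_comb_moments(2)[OF lD]
    by (simp add: v_eq)
  finally have vX: "variance X = v s / 2 + v t / 2 - v (t - s) / 4" .
  note mgf = centered_gaussian_mgf[OF gaussian_lin_comb expectation_lin_comb, OF lX lX]
  have eq: "exp ((W s \<omega> + W t \<omega>) / 2) = exp (- (v s + v t) / 4) * exp (X \<omega>)" for \<omega>
    unfolding mult_exp_exp by (simp add: X_def drifted_process_def field_simps)
  show "integrable M (\<lambda>\<omega>. exp ((W s \<omega> + W t \<omega>) / 2))"
    unfolding eq using mgf(1) by simp
  have "expectation (\<lambda>\<omega>. exp ((W s \<omega> + W t \<omega>) / 2)) = exp (- (v s + v t) / 4) * exp (variance X / 2)"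
    unfolding eq using mgf(2) by simp
  also have "\<dots> = exp (- v (t - s) / 8)"
    unfolding mult_exp_exp vX by (simp add: field_simps)
  finally show "expectation (\<lambda>\<omega>. exp ((W s \<omega> + W t \<omega>) / 2)) = exp (- v (t - s) / 8)" .
qed

lemma bdd_above_exp_W:
  assumes "\<omega> \<in> space M"
  shows "bdd_above ((\<lambda>t. exp (W t \<omega>)) ` {a..b})"
  using assms by (intro compact_imp_bounded[THEN bounded_imp_bdd_above] compact_continuous_image
    continuous_on_exp W_continuous compact_Icc)

lemma exp_W_le_sup_exp:
  assumes "\<omega> \<in> space M" "t \<in> {a..b}"
  shows "exp (W t \<omega>) \<le> sup_exp W {a..b} \<omega>"
  unfolding sup_exp_def using assms bdd_above_exp_W by (intro cSUP_upper)

lemma sup_exp_nonneg: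
  assumes "\<omega> \<in> space M" "a \<le> b"
  shows "0 \<le> sup_exp W {a..b} \<omega>"
  by (rule order_trans[OF exp_ge_zero exp_W_le_sup_exp[of \<omega> a]]) (use assms in auto)

lemma sup_exp_subset:
  assumes "\<omega> \<in> space M" "{a..b} \<subseteq> {c..d}" "a \<le> b"
  shows "sup_exp W {a..b} \<omega> \<le> sup_exp W {c..d} \<omega>"
  unfolding sup_exp_def using assms bdd_above_exp_W by (intro cSUP_subset_mono) auto

context
  assumes cs: "compact_sup_integrable M W"
begin

lemma sup_exp_integrable: "a \<le> b \<Longrightarrow> integrable M (sup_exp W {a..b})"
  using cs by (simp add: compact_sup_integrable_def)

lemma expectation_sup_exp_nonneg: "a \<le> b \<Longrightarrow> 0 \<le> expectation (sup_exp W {a..b})"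
  by (intro integral_nonneg_AE AE_I2 sup_exp_nonneg)

lemma expectation_sup_exp_shift:
  assumes "a \<le> b"
  shows "expectation (sup_exp W {a + h..b + h}) = expectation (sup_exp W {a..b})"
proof -
  have *: "ennreal (expectation (sup_exp W {a..b})) = (\<integral>\<^sup>+\<omega>. (SUP t\<in>{a..b}. ennreal (exp (W t \<omega>))) \<partial>M)"
    if "a \<le> b" for a b
  proof -
    have "ennreal (expectation (sup_exp W {a..b})) = (\<integral>\<^sup>+\<omega>. ennreal (sup_exp W {a..b} \<omega>) \<partial>M)"
      using that by (intro nn_integral_eq_integral[symmetric] sup_exp_integrable AE_I2 sup_exp_nonneg)
    also have "\<dots> = (\<integral>\<^sup>+\<omega>. (SUP t\<in>{a..b}. ennreal (exp (W t \<omega>))) \<partial>M)"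
    proof (rule nn_integral_cong)
      fix \<omega> assume \<omega>: "\<omega> \<in> space M"
      \<comment> \<open>The real and the \<open>ennreal\<close> supremum may be identified only once
        the latter is known to be finite.\<close>
      have "(SUP t\<in>{a..b}. ennreal (exp (W t \<omega>))) \<le> ennreal (sup_exp W {a..b} \<omega>)"
        by (intro SUP_least ennreal_leI exp_W_le_sup_exp \<omega>)
      also have "\<dots> < \<top>" by simp
      finally have "(SUP t\<in>{a..b}. ennreal (exp (W t \<omega>))) \<noteq> \<top>" by (rule less_imp_neq)
      then show "ennreal (sup_exp W {a..b} \<omega>) = (SUP t\<in>{a..b}. ennreal (exp (W t \<omega>)))"
        unfolding sup_exp_def by (rule ennreal_SUP) (use that in simp)
    qed
    finally show ?thesis .
  qed
  have "ennreal (expectation (sup_exp W {a + h..b + h})) = ennreal (expectation (sup_exp W {a..b}))"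
    using assms by (simp add: * nn_integral_sup_shift)
  then show ?thesis using assms by (simp add: ennreal_inj expectation_sup_exp_nonneg)
qed

lemma expectation_sup_exp_subadditive:
  assumes "0 < S" "0 < T"
  shows "expectation (sup_exp W {0..S + T}) \<le> expectation (sup_exp W {0..S}) + expectation (sup_exp W {0..T})"
proof -
  \<comment> \<open>The second block is the interval from \<open>S\<close> to \<open>S + T\<close>,
    written as a translate of \<open>{0..T}\<close> to fit the shift lemma. A maximum of nonnegative
    numbers is at most their sum.\<close>
  have "expectation (sup_exp W {0..S + T}) \<le> expectation (\<lambda>\<omega>. sup_exp W {0..S} \<omega> + sup_exp W {0 + S..T + S} \<omega>)"
  proof (rule integral_mono)
    show "integrable M (sup_exp W {0..S + T})" using assms by (intro sup_exp_integrable) simp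
    show "integrable M (\<lambda>\<omega>. sup_exp W {0..S} \<omega> + sup_exp W {0 + S..T + S} \<omega>)"
      using assms by (intro Bochner_Integration.integrable_add sup_exp_integrable) auto
    fix \<omega> assume \<omega>: "\<omega> \<in> space M"
    have nn: "0 \<le> sup_exp W {0..S} \<omega>" "0 \<le> sup_exp W {0 + S..T + S} \<omega>"
      using \<omega> assms by (auto intro!: sup_exp_nonneg)
    show "sup_exp W {0..S + T} \<omega> \<le> sup_exp W {0..S} \<omega> + sup_exp W {0 + S..T + S} \<omega>"
      unfolding sup_exp_def[of W "{0..S + T}"]
    proof (rule cSUP_least)
      fix t assume t: "t \<in> {0..S + T}"
      consider "t \<in> {0..S}" | "t \<in> {0 + S..T + S}" using t by force
      then show "exp (W t \<omega>) \<le> sup_exp W {0..S} \<omega> + sup_exp W {0 + S..T + S} \<omega>"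
        using exp_W_le_sup_exp[OF \<omega>] nn by cases (metis add_increasing2, metis add_increasing)
    qed (use assms in auto)
  qed
  also have "\<dots> = expectation (sup_exp W {0..S}) + expectation (sup_exp W {0 + S..T + S})"
    using assms by (intro Bochner_Integration.integral_add sup_exp_integrable) auto
  also have "expectation (sup_exp W {0 + S..T + S}) = expectation (sup_exp W {0..T})"
    using assms by (intro expectation_sup_exp_shift) simp
  finally show ?thesis .
qed

text \<open>The \<open>n\<close> lattice points from 0 to \<open>(n - 1) * a\<close> lie in the
  interval, and \<open>?y j k\<close> is the geometric mean of \<open>?x j\<close> and
  \<open>?x k\<close>, so the maximum inequality can be integrated term by term.\<close>

lemma expectation_sup_exp_lower_bound:
  assumes "a > 0"
  shows "real n - (\<Sum>k<n. \<Sum>m<k. exp (- v (a * real (Suc m)) / 8)) \<le> expectation (sup_exp W {0..real n * a})"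
proof -
  let ?x = "\<lambda>k \<omega>. exp (W (real k * a) \<omega>)"
  let ?y = "\<lambda>j k \<omega>. exp ((W (real j * a) \<omega> + W (real k * a) \<omega>) / 2)"
  have "expectation (\<lambda>\<omega>. (\<Sum>k<n. ?x k \<omega>) - (\<Sum>k<n. \<Sum>j<k. ?y j k \<omega>)) \<le> expectation (sup_exp W {0..real n * a})"
  proof (rule integral_mono)
    show "integrable M (\<lambda>\<omega>. (\<Sum>k<n. ?x k \<omega>) - (\<Sum>k<n. \<Sum>j<k. ?y j k \<omega>))"
      by (intro Bochner_Integration.integrable_diff Bochner_Integration.integrable_sum
        exp_W_integrable expectation_exp_average)
    show "integrable M (sup_exp W {0..real n * a})" using assms by (intro sup_exp_integrable) simp
    fix \<omega> assume \<omega>: "\<omega> \<in> space M"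
    have sq: "?y j k \<omega> = sqrt (?x j \<omega> * ?x k \<omega>)" for j k
      unfolding mult_exp_exp by (rule real_sqrt_unique[symmetric]) (simp_all add: power2_eq_square mult_exp_exp)
    show "(\<Sum>k<n. ?x k \<omega>) - (\<Sum>k<n. \<Sum>j<k. ?y j k \<omega>) \<le> sup_exp W {0..real n * a} \<omega>"
      unfolding sq using \<omega> assms
      by (intro sum_minus_sqrt_le_upper_bound exp_W_le_sup_exp sup_exp_nonneg) auto
  qed
  moreover have "expectation (\<lambda>\<omega>. (\<Sum>k<n. ?x k \<omega>) - (\<Sum>k<n. \<Sum>j<k. ?y j k \<omega>)) =
      real n - (\<Sum>k<n. \<Sum>j<k. exp (- v (real k * a - real j * a) / 8))"
    by (simp add: exp_W_integrable expectation_exp_W expectation_exp_average)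
  \<comment> \<open>The lag \<open>k - j\<close> runs from 1 to \<open>k\<close>; reversing the
    order by \<open>m = k - Suc j\<close> writes it as \<open>Suc m\<close>.\<close>
  moreover have "(\<Sum>j<k. exp (- v (real k * a - real j * a) / 8)) = (\<Sum>m<k. exp (- v (a * real (Suc m)) / 8))" for k
  proof -
    have "(\<Sum>j<k. exp (- v (real k * a - real j * a) / 8)) = (\<Sum>j<k. exp (- v (a * real (Suc (k - Suc j))) / 8))"
    proof (rule sum.cong[OF refl])
      fix j assume "j \<in> {..<k}"
      then have "real (Suc (k - Suc j)) = real k - real j" by (simp add: of_nat_diff)
      then show "exp (- v (real k * a - real j * a) / 8) = exp (- v (a * real (Suc (k - Suc j))) / 8)"
        by (simp only: right_diff_distrib mult.commute)
    qed
    then show ?thesis by (simp only: sum.nat_diff_reindex[of "\<lambda>m. exp (- v (a * real (Suc m)) / 8)"])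
  qed
  ultimately show ?thesis by simp
qed

lemma pickands_constant_pos:
  assumes "Liminf at_top (\<lambda>t. ereal (v t / ln t)) > 8"
  shows "(pickands_mean M W \<longlongrightarrow> pickands_constant M W) at_top \<and> pickands_constant M W > 0"
proof -
  let ?f = "\<lambda>T. expectation (sup_exp W {0..T})"
  obtain L where "((\<lambda>T. ?f T / T) \<longlongrightarrow> L) at_top"
  proof (rule subadditive_quotient_tendsto)
    fix S T :: real assume "0 < S" "S \<le> T"
    then show "?f S \<le> ?f T" by (intro integral_mono sup_exp_integrable sup_exp_subset) auto
  qed (auto intro: expectation_sup_exp_subadditive expectation_sup_exp_nonneg)
  then have L: "(pickands_mean M W \<longlongrightarrow> L) at_top" by (simp add: pickands_mean_def[abs_def])
  then have const: "pickands_constant M W = L" unfolding pickands_constant_def by (intro tendsto_Lim) auto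
  obtain a where a: "a > 0" "\<And>k. (\<Sum>m<k. exp (- v (a * real (Suc m)) / 8)) \<le> 1 / 2"
    using log_growth_exp_sum_le[OF assms] by metis
  \<comment> \<open>Since the full limit exists, it can be evaluated along \<open>T = n * a\<close>.
    The pair terms cost at most \<open>n / 2\<close> in total, and \<open>n / 2\<close> divided by
    \<open>n * a\<close> gives the bound; \<open>n\<close> starts at 1 to keep the divisor
    positive.\<close>
  have "1 / (2 * a) \<le> L"
  proof (rule LIMSEQ_le_const)
    show "(\<lambda>n. pickands_mean M W (real n * a)) \<longlonglongrightarrow> L"
      by (rule filterlim_compose[OF L])
        (intro filterlim_at_top_mult_tendsto_pos[OF tendsto_const a(1)] filterlim_real_sequentially)
    show "\<exists>N. \<forall>n\<ge>N. 1 / (2 * a) \<le> pickands_mean M W (real n * a)"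
    proof (intro exI[of _ 1] allI impI)
      fix n :: nat assume n: "n \<ge> 1"
      have "(\<Sum>k<n. \<Sum>m<k. exp (- v (a * real (Suc m)) / 8)) \<le> (\<Sum>k<n. 1 / 2)"
        by (intro sum_mono a(2))
      then have "real n / 2 \<le> ?f (real n * a)"
        using expectation_sup_exp_lower_bound[OF a(1), of n] by simp
      then have "(real n / 2) / (real n * a) \<le> ?f (real n * a) / (real n * a)"
        using a(1) by (intro divide_right_mono) auto
      then show "1 / (2 * a) \<le> pickands_mean M W (real n * a)"
        using n by (simp add: pickands_mean_def)
    qed
  qed
  then show ?thesis using L a(1) unfolding const by (auto intro: less_le_trans[of 0 "1 / (2 * a)"])
qed

end

end

theorem theorem2p2:
  fixes M :: "'a measure" and B W :: "real \<Rightarrow> 'a \<Rightarrow> real"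
  assumes "prob_space M"
    and "gaussian_process M B"
    and "centered_process M B"
    and "stationary_increments M B"
    and "continuous_paths M B"
    and "AE \<omega> in M. B 0 \<omega> = 0"
    and "W = drifted_process M B"
    and "compact_sup_integrable M W"
    and "Liminf at_top (\<lambda>t. ereal (variance_function M B t / ln t)) > 8"
  shows "(pickands_mean M W \<longlongrightarrow> pickands_constant M W) at_top \<and> pickands_constant M W > 0"
proof -
  interpret gaussian_increments M B
    using assms by (simp add: gaussian_increments_def gaussian_increments_axioms_def)
  show ?thesis using pickands_constant_pos assms(7-9) by simp
qed

end
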